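(* Let $E=\mathbb Ze_1\oplus\mathbb Ze_2$, $W=\mathbb Zf$, and let $\mu:E^{\otimes3}\to W$ be the tensor with $\mu(e_i,e_j,e_k)=-f$ if $(i,j,k)=(2,2,2)$ and $\mu(e_i,e_j,e_k)=f$ otherwise. Let $T_\pm=E\oplus W$ be the corresponding two-step ternary ring and let $p_{ij}=e_i\otimes e_j$. Then $Q_\mu\cong\mathbb Z/2\mathbb Z$. If $q$ denotes the nonzero element of $Q_\mu$, every product of two basis elements $p_{ij}$ in $\mathcal O(T_\pm,\mathbb Z)$ equals $q$. Therefore $$\mathfrak D(T_\pm,\mathbb Z)=\mathfrak K(T_\pm,\mathbb Z)=\mathcal C(T_\pm,\mathbb Z)\cong\mathbb Z^2\oplus\mathbb Z/2\mathbb Z.$$ Moreover, the operator rng $\mathcal O(T_\pm,\mathbb Z)$ annihilates the defect on both sides, and the regular square-zero extension $0\to\mathfrak K(T_\pm,\mathbb Z)\to\mathcal A(T_\pm,\mathbb Z)\to\mathcal R_{T_\pm}\to0$ is nonsplit.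
   Context: The two-step ternary ring $T_\mu=E\oplus W$ has $\Gamma=\mathbb Z$ and operation $(x+u)\,n\,(y+v)\,m\,(z+w)=nm\,\mu(x,y,z)$ for $x,y,z\in E$, $u,v,w\in W$. Put $Q_\mu=\operatorname{coker}B_\mu$, where $B_\mu:E^{\otimes4}\to(W\otimes E)\oplus(E\otimes W)$, $B_\mu(a\otimes b\otimes c\otimes d)=\mu(a,b,c)\otimes d-a\otimes\mu(b,c,d)$. For an additive ternary $\Gamma$-ring $T$ (abelian groups $T,\Gamma$ with an operation $x\alpha y\beta z\in T$ additive in all five variables and satisfying $(x\alpha y\beta z)\gamma u\delta v=x\alpha(y\beta z\gamma u)\delta v=x\alpha y\beta(z\gamma u\delta v)$): $F(T,\Gamma)=T\otimes_{\mathbb Z}\Gamma\otimes_{\mathbb Z}T\otimes_{\mathbb Z}\Gamma$ carries the associative multiplication $(a\otimes\alpha\otimes b\otimes\beta)(c\otimes\gamma\otimes d\otimes\delta)=(a\alpha b\beta c)\otimes\gamma\otimes d\otimes\delta$; $\mathcal O(T,\Gamma)$ is its quotient by the two-sided ideal generated by all $(a\alpha b\beta c)\otimes\gamma\otimes d\otimes\delta-a\otimes\alpha\otimes(b\beta c\gamma d)\otimes\delta$; $[a,\alpha,b,\beta]$ is the class of a pure tensor; $\mathcal A(T,\Gamma)=\mathbb Z\oplus\mathcal O(T,\Gamma)$ with $(n,r)(m,s)=(nm,ns+mr+rs)$. The regular representation is $\rho_T:\mathcal O(T,\Gamma)\to\operatorname{End}_{\mathbb Z}(T)$, $\rho_T([a,\alpha,b,\beta])(x)=a\alpha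 b\beta x$, and $\widehat\rho_T(n,u)=n\operatorname{id}_T+\rho_T(u)$ on $\mathcal A(T,\Gamma)$. Then $\mathfrak D(T,\Gamma)=\ker\rho_T$, $\mathfrak K(T,\Gamma)=\ker\widehat\rho_T$, $\mathcal R_T=\operatorname{im}\widehat\rho_T\cong\mathcal A/\mathfrak K$, $\mathcal C(T,\Gamma)=\mathfrak K/\mathfrak K^2$. $\mathfrak D$ is viewed inside $\mathcal A$ via $u\mapsto(0,u)$. For a two-step system with $\Gamma=\mathbb Z$, $F(T_\mu,\mathbb Z)=T_\mu\otimes T_\mu$ and there is an identification of abelian groups $\mathcal O(T_\mu,\mathbb Z)\cong(E\otimes E)\oplus Q_\mu$, where $E\otimes E$, $W\otimes E$, $E\otimes W$ map to $\mathcal O$ by taking classes; and $\mathfrak K^2=0$. Nonsplit means that $\mathcal A\twoheadrightarrow\mathcal R_T$ admits no unital ring section (equivalently, its Hochschild extension class in $\operatorname{HH}^2_{\mathbb Z}(\mathcal R_T,\mathfrak K)$ is nonzero). *)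

theory Defs
  imports Complex_Main "HOL-Algebra.Ideal_Product" "HOL-Algebra.QuotRing" "HOL-Algebra.Free_Abelian_Groups" "HOL-Algebra.Elementary_Groups" "HOL-Library.Product_Plus"
begin

section \<open>Tensor product of abelian groups\<close>

text \<open>
  The tensor product over the integers of two abelian groups, given as types of class
  \<open>ab_group_add\<close>: the free abelian group on pairs modulo the biadditivity relations.
\<close>

inductive_set tensor_relations :: "('a::ab_group_add \<times> 'b::ab_group_add \<Rightarrow>\<^sub>0 int) set" where
  zero: "0 \<in> tensor_relations"
| left: "frag_of (a + a', b) - frag_of (a, b) - frag_of (a', b) \<in> tensor_relations"
| right: "frag_of (a, b + b') - frag_of (a, b) - frag_of (a, b') \<in> tensor_relations"
| diff: "x \<in> tensor_relations \<Longrightarrow> y \<in> tensor_relations \<Longrightarrow> x - y \<in> tensor_relations"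

lemma tensor_relations_uminus: "x \<in> tensor_relations \<Longrightarrow> - x \<in> tensor_relations"
  using tensor_relations.diff[OF tensor_relations.zero, of x] by simp

lemma tensor_relations_add:
  assumes "x \<in> tensor_relations" "y \<in> tensor_relations"
  shows "x + y \<in> tensor_relations"
  using tensor_relations.diff[OF assms(1) tensor_relations_uminus[OF assms(2)]] by simp

definition tensor_rel ::
    "('a::ab_group_add \<times> 'b::ab_group_add \<Rightarrow>\<^sub>0 int) \<Rightarrow> ('a \<times> 'b \<Rightarrow>\<^sub>0 int) \<Rightarrow> bool" where
  "tensor_rel x y \<longleftrightarrow> x - y \<in> tensor_relations"

quotient_type (overloaded) ('a, 'b) tensor (infixr \<open>\<otimes>\<^sub>\<int>\<close> 75) =
    "('a::ab_group_add \<times> 'b::ab_group_add) \<Rightarrow>\<^sub>0 int" / tensor_rel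
proof (rule equivpI)
  show "reflp tensor_rel"
    by (simp add: reflp_def tensor_rel_def tensor_relations.zero)
  show "symp tensor_rel"
    unfolding symp_def tensor_rel_def by (metis minus_diff_eq tensor_relations_uminus)
  show "transp tensor_rel"
    unfolding transp_def tensor_rel_def using tensor_relations_add by fastforce
qed

instantiation tensor :: (ab_group_add, ab_group_add) ab_group_add
begin

lift_definition zero_tensor :: "('a, 'b) tensor" is 0 .

lift_definition plus_tensor :: "('a, 'b) tensor \<Rightarrow> ('a, 'b) tensor \<Rightarrow> ('a, 'b) tensor" is "(+)"
  unfolding tensor_rel_def by (simp only: add_diff_add tensor_relations_add)

lift_definition uminus_tensor :: "('a, 'b) tensor \<Rightarrow> ('a, 'b) tensor" is uminus
proof -
  fix x y :: "'a \<times> 'b \<Rightarrow>\<^sub>0 int"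
  assume "tensor_rel x y"
  then show "tensor_rel (- x) (- y)"
    using tensor_relations_uminus[of "x - y"] by (simp add: tensor_rel_def)
qed

lift_definition minus_tensor :: "('a, 'b) tensor \<Rightarrow> ('a, 'b) tensor \<Rightarrow> ('a, 'b) tensor" is "(-)"
proof -
  fix x y u v :: "'a \<times> 'b \<Rightarrow>\<^sub>0 int"
  assume "tensor_rel x y" "tensor_rel u v"
  then have "(x - y) - (u - v) \<in> tensor_relations"
    unfolding tensor_rel_def by (rule tensor_relations.diff)
  then show "tensor_rel (x - u) (y - v)"
    by (simp add: tensor_rel_def algebra_simps)
qed

instance
  by standard (transfer, simp add: tensor_rel_def tensor_relations.zero algebra_simps)+

end

lift_definition pure_tensor :: "'a::ab_group_add \<Rightarrow> 'b::ab_group_add \<Rightarrow> 'a \<otimes>\<^sub>\<int> 'b"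
    (infixr \<open>\<otimes>\<^sub>\<int>\<close> 75) is "\<lambda>a b. frag_of (a, b)" .

lemma pure_tensor_add:
  "(a + a') \<otimes>\<^sub>\<int> b = a \<otimes>\<^sub>\<int> b + a' \<otimes>\<^sub>\<int> b" "a \<otimes>\<^sub>\<int> (b + b') = a \<otimes>\<^sub>\<int> b + a \<otimes>\<^sub>\<int> b'"
  by (transfer, use tensor_relations.left in \<open>force simp: tensor_rel_def algebra_simps\<close>)
     (transfer, use tensor_relations.right in \<open>force simp: tensor_rel_def algebra_simps\<close>)

lemma pure_tensor_zero [simp]: "a \<otimes>\<^sub>\<int> 0 = 0" "0 \<otimes>\<^sub>\<int> b = 0"
  using pure_tensor_add(2)[of a 0 0] pure_tensor_add(1)[of 0 0 b] by simp_all

lemma pure_tensor_diff: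
  "(a - a') \<otimes>\<^sub>\<int> b = a \<otimes>\<^sub>\<int> b - a' \<otimes>\<^sub>\<int> b" "a \<otimes>\<^sub>\<int> (b - b') = a \<otimes>\<^sub>\<int> b - a \<otimes>\<^sub>\<int> b'"
  using pure_tensor_add(1)[of "a - a'" a' b] pure_tensor_add(2)[of a "b - b'" b']
  by (simp_all add: eq_diff_eq)

definition biadditive ::
    "('a::ab_group_add \<Rightarrow> 'b::ab_group_add \<Rightarrow> 'c::ab_group_add) \<Rightarrow> bool" where
  "biadditive f \<longleftrightarrow> (\<forall>b. additive (\<lambda>a. f a b)) \<and> (\<forall>a. additive (f a))"

text \<open>The universal property; meaningful only for biadditive \<open>f\<close>.\<close>

definition tensor_lift ::
    "('a::ab_group_add \<Rightarrow> 'b::ab_group_add \<Rightarrow> 'c::ab_group_add) \<Rightarrow> 'a \<otimes>\<^sub>\<int> 'b \<Rightarrow> 'c" where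
  "tensor_lift f = (THE g. additive g \<and> (\<forall>a b. g (a \<otimes>\<^sub>\<int> b) = f a b))"

definition additive_group :: "'a::ab_group_add monoid" where
  "additive_group = \<lparr>carrier = UNIV, monoid.mult = (+), one = 0\<rparr>"

lemma comm_group_additive_group: "comm_group (additive_group :: 'a::ab_group_add monoid)"
proof (rule comm_groupI)
  show "\<exists>y\<in>carrier additive_group. y \<otimes>\<^bsub>additive_group\<^esub> x = \<one>\<^bsub>additive_group\<^esub>" for x :: 'a
    by (rule bexI[of _ "- x"]) (auto simp: additive_group_def)
qed (auto simp: additive_group_def algebra_simps)

lemma tensor_induct [case_names zero pure diff]:
  fixes t :: "'a::ab_group_add \<otimes>\<^sub>\<int> 'b::ab_group_add"
  assumes "P 0" and "\<And>a b. P (a \<otimes>\<^sub>\<int> b)" and "\<And>s t. P s \<Longrightarrow> P t \<Longrightarrow> P (s - t)"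
  shows "P t"
proof -
  have "P (abs_tensor u)" for u :: "'a \<times> 'b \<Rightarrow>\<^sub>0 int"
    using subset_UNIV[of "Poly_Mapping.keys u"]
  proof (induction rule: frag_induction)
    case zero
    show ?case using assms(1) by (simp add: zero_tensor_def)
  next
    case (one x)
    obtain a b where "x = (a, b)" by (cases x)
    then show ?case using assms(2)[of a b] by (simp add: pure_tensor.abs_eq)
  next
    case (diff x y)
    then show ?case using assms(3) by (metis minus_tensor.abs_eq)
  qed
  then show ?thesis by (metis Quotient_tensor Quotient_abs_rep)
qed

lemma tensor_lift_unique:
  fixes g h :: "'a::ab_group_add \<otimes>\<^sub>\<int> 'b::ab_group_add \<Rightarrow> 'c::ab_group_add"
  assumes "additive g" "additive h" "\<And>a b. g (a \<otimes>\<^sub>\<int> b) = h (a \<otimes>\<^sub>\<int> b)"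
  shows "g = h"
proof
  fix t
  show "g t = h t"
    by (induction t rule: tensor_induct)
       (use assms in \<open>simp_all add: additive.zero additive.diff\<close>)
qed

lemma tensor_lift_exists:
  fixes f :: "'a::ab_group_add \<Rightarrow> 'b::ab_group_add \<Rightarrow> 'c::ab_group_add"
  assumes f: "biadditive f"
  shows "\<exists>g. additive g \<and> (\<forall>a b. g (a \<otimes>\<^sub>\<int> b) = f a b)"
proof -
  interpret G: comm_group "additive_group :: 'c monoid"
    by (rule comm_group_additive_group)
  obtain h where h: "h \<in> hom (free_Abelian_group UNIV) (additive_group :: 'c monoid)"
    and hf: "\<And>x. x \<in> UNIV \<Longrightarrow> h (frag_of x) = case_prod f x"
    by (rule G.free_Abelian_group_universal[of "case_prod f" UNIV])
       (auto simp: additive_group_def)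
  have add: "additive h"
    by unfold_locales
       (use h in \<open>simp add: hom_def free_Abelian_group_def additive_group_def\<close>)
  interpret additive h by (rule add)
  have f1: "f (a + a') b = f a b + f a' b" for a a' b
    using f additive.add[of "\<lambda>a. f a b"] by (simp add: biadditive_def)
  have f2: "f a (b + b') = f a b + f a b'" for a b b'
    using f additive.add[of "f a"] by (simp add: biadditive_def)
  have rel: "h x = 0" if "x \<in> tensor_relations" for x
    using that by induction (simp_all add: zero diff hf f1 f2)
  have wd: "h x = h y" if "tensor_rel x y" for x y
    using rel[of "x - y"] that by (simp add: tensor_rel_def diff)
  define g where "g t = h (rep_tensor t)" for t
  have g_abs: "g (abs_tensor x) = h x" for x
    unfolding g_def
    by (rule wd, rule Quotient3_rep_abs[OF Quotient3_tensor])
       (simp add: tensor_rel_def tensor_relations.zero)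
  have "g (s + t) = g s + g t" for s t
  proof -
    obtain x y where "s = abs_tensor x" "t = abs_tensor y"
      by (metis Quotient_tensor Quotient_abs_rep)
    then show ?thesis by (simp add: plus_tensor.abs_eq g_abs local.add)
  qed
  then have "additive g" by unfold_locales
  moreover have "g (a \<otimes>\<^sub>\<int> b) = f a b" for a b
    by (simp add: pure_tensor.abs_eq g_abs hf)
  ultimately show ?thesis by blast
qed

lemma
  assumes "biadditive f"
  shows additive_tensor_lift: "additive (tensor_lift f)"
    and tensor_lift_pure: "tensor_lift f (a \<otimes>\<^sub>\<int> b) = f a b"
proof -
  have "\<exists>!g. additive g \<and> (\<forall>a b. g (a \<otimes>\<^sub>\<int> b) = f a b)"
    using tensor_lift_exists[OF assms] tensor_lift_unique by (metis (no_types, lifting))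
  from theI'[OF this] show "additive (tensor_lift f)" "tensor_lift f (a \<otimes>\<^sub>\<int> b) = f a b"
    unfolding tensor_lift_def by blast+
qed

definition tensor_lift4 ::
    "('a::ab_group_add \<Rightarrow> 'b::ab_group_add \<Rightarrow> 'c::ab_group_add \<Rightarrow> 'd::ab_group_add
       \<Rightarrow> 'e::ab_group_add) \<Rightarrow> 'a \<otimes>\<^sub>\<int> 'b \<otimes>\<^sub>\<int> 'c \<otimes>\<^sub>\<int> 'd \<Rightarrow> 'e" where
  "tensor_lift4 f =
     tensor_lift (\<lambda>a. tensor_lift (\<lambda>b. tensor_lift (\<lambda>c d. f a b c d)))"

lemma additive_iff: "additive f \<longleftrightarrow> (\<forall>x y. f (x + y) = f x + f y)"
  by (auto simp: additive_def)

definition quadadditive ::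
    "('a::ab_group_add \<Rightarrow> 'b::ab_group_add \<Rightarrow> 'c::ab_group_add \<Rightarrow> 'd::ab_group_add
       \<Rightarrow> 'e::ab_group_add) \<Rightarrow> bool" where
  "quadadditive f \<longleftrightarrow>
     (\<forall>b c d. additive (\<lambda>a. f a b c d)) \<and> (\<forall>a c d. additive (\<lambda>b. f a b c d)) \<and>
     (\<forall>a b d. additive (\<lambda>c. f a b c d)) \<and> (\<forall>a b c. additive (f a b c))"

lemma tensor_lift_add:
  assumes "biadditive f" "biadditive g" "biadditive h" "\<And>a b. h a b = f a b + g a b"
  shows "tensor_lift h t = tensor_lift f t + tensor_lift g t"
proof -
  have "tensor_lift h = (\<lambda>t. tensor_lift f t + tensor_lift g t)"
    using additive_tensor_lift[OF assms(1)] additive_tensor_lift[OF assms(2)]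
    by (intro tensor_lift_unique additive_tensor_lift assms(3))
       (simp_all add: additive_iff tensor_lift_pure assms algebra_simps)
  then show ?thesis by simp
qed

lemma quadadditive_lifts:
  assumes f: "quadadditive f"
  shows "biadditive (f a b)"
    and "biadditive (\<lambda>b. tensor_lift (f a b))"
    and "biadditive (\<lambda>a. tensor_lift (\<lambda>b. tensor_lift (f a b)))"
proof -
  have f1: "f (x + y) b c d = f x b c d + f y b c d"
    and f2: "f a (x' + y') c d = f a x' c d + f a y' c d" for a b c d x y x' y'
    using f unfolding quadadditive_def additive_iff by blast+
  show b3: "biadditive (f a b)" for a b
    using f by (auto simp: quadadditive_def biadditive_def)
  show b2: "biadditive (\<lambda>b. tensor_lift (f a b))" for a
    unfolding biadditive_def
  proof (intro conjI allI)
    show "additive (\<lambda>b. tensor_lift (f a b) t)" for t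
      unfolding additive_iff by (intro allI tensor_lift_add[OF b3 b3 b3] f2)
  qed (rule additive_tensor_lift[OF b3])
  show "biadditive (\<lambda>a. tensor_lift (\<lambda>b. tensor_lift (f a b)))"
    unfolding biadditive_def
  proof (intro conjI allI)
    show "additive (\<lambda>a. tensor_lift (\<lambda>b. tensor_lift (f a b)) t)" for t
      unfolding additive_iff
      by (intro allI tensor_lift_add[OF b2 b2 b2] tensor_lift_add[OF b3 b3 b3] f1)
  qed (rule additive_tensor_lift[OF b2])
qed

lemma
  assumes f: "quadadditive f"
  shows additive_tensor_lift4: "additive (tensor_lift4 f)"
    and tensor_lift4_pure: "tensor_lift4 f (a \<otimes>\<^sub>\<int> b \<otimes>\<^sub>\<int> c \<otimes>\<^sub>\<int> d) = f a b c d"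
  unfolding tensor_lift4_def
  by (simp_all add: additive_tensor_lift tensor_lift_pure quadadditive_lifts[OF f])

lemma tensor_lift4_add:
  assumes "quadadditive f" "quadadditive g" "quadadditive h"
    and "\<And>a b c d. h a b c d = f a b c d + g a b c d"
  shows "tensor_lift4 h t = tensor_lift4 f t + tensor_lift4 g t"
  unfolding tensor_lift4_def
  by (intro assms(4)
      tensor_lift_add[OF quadadditive_lifts(3) quadadditive_lifts(3) quadadditive_lifts(3)]
      tensor_lift_add[OF quadadditive_lifts(2) quadadditive_lifts(2) quadadditive_lifts(2)]
      tensor_lift_add[OF quadadditive_lifts(1) quadadditive_lifts(1) quadadditive_lifts(1)] assms(1-3))


section \<open>Ternary gamma-rings and their operator rng\<close>

type_synonym ('t, 'g) ternary_op = "'t \<Rightarrow> 'g \<Rightarrow> 't \<Rightarrow> 'g \<Rightarrow> 't \<Rightarrow> 't"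

definition ternary_gamma_ring :: "('t::ab_group_add, 'g::ab_group_add) ternary_op \<Rightarrow> bool" where
  "ternary_gamma_ring op \<longleftrightarrow>
     (\<forall>\<alpha> y \<beta> z. additive (\<lambda>x. op x \<alpha> y \<beta> z)) \<and>
     (\<forall>x y \<beta> z. additive (\<lambda>\<alpha>. op x \<alpha> y \<beta> z)) \<and>
     (\<forall>x \<alpha> \<beta> z. additive (\<lambda>y. op x \<alpha> y \<beta> z)) \<and>
     (\<forall>x \<alpha> y z. additive (\<lambda>\<beta>. op x \<alpha> y \<beta> z)) \<and>
     (\<forall>x \<alpha> y \<beta>. additive (\<lambda>z. op x \<alpha> y \<beta> z)) \<and>
     (\<forall>x \<alpha> y \<beta> z \<gamma> u \<delta> v.
        op (op x \<alpha> y \<beta> z) \<gamma> u \<delta> v = op x \<alpha> (op y \<beta> z \<gamma> u) \<delta> v \<and>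
        op x \<alpha> (op y \<beta> z \<gamma> u) \<delta> v = op x \<alpha> y \<beta> (op z \<gamma> u \<delta> v))"

type_synonym ('t, 'g) tensor4 = "'t \<otimes>\<^sub>\<int> 'g \<otimes>\<^sub>\<int> 't \<otimes>\<^sub>\<int> 'g"

definition F_mult :: "('t::ab_group_add, 'g::ab_group_add) ternary_op
    \<Rightarrow> ('t, 'g) tensor4 \<Rightarrow> ('t, 'g) tensor4 \<Rightarrow> ('t, 'g) tensor4" where
  "F_mult op s t =
     tensor_lift4 (\<lambda>a \<alpha> b \<beta>.
       tensor_lift4 (\<lambda>c \<gamma> d \<delta>. op a \<alpha> b \<beta> c \<otimes>\<^sub>\<int> \<gamma> \<otimes>\<^sub>\<int> d \<otimes>\<^sub>\<int> \<delta>) t) s"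

lemma F_mult_pure:
  fixes op :: "('t::ab_group_add, 'g::ab_group_add) ternary_op"
  assumes "ternary_gamma_ring op"
  shows "F_mult op (a \<otimes>\<^sub>\<int> \<alpha> \<otimes>\<^sub>\<int> b \<otimes>\<^sub>\<int> \<beta>) (c \<otimes>\<^sub>\<int> \<gamma> \<otimes>\<^sub>\<int> d \<otimes>\<^sub>\<int> \<delta>) =
    op a \<alpha> b \<beta> c \<otimes>\<^sub>\<int> \<gamma> \<otimes>\<^sub>\<int> d \<otimes>\<^sub>\<int> \<delta>"
proof -
  have inner: "quadadditive (\<lambda>c \<gamma> d \<delta>. op a \<alpha> b \<beta> c \<otimes>\<^sub>\<int> \<gamma> \<otimes>\<^sub>\<int> d \<otimes>\<^sub>\<int> \<delta>)" for a \<alpha> b \<beta>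
    using assms by (simp add: ternary_gamma_ring_def quadadditive_def additive_iff pure_tensor_add)
  have "quadadditive (\<lambda>a \<alpha> b \<beta>.
      tensor_lift4 (\<lambda>c \<gamma> d \<delta>. op a \<alpha> b \<beta> c \<otimes>\<^sub>\<int> \<gamma> \<otimes>\<^sub>\<int> d \<otimes>\<^sub>\<int> \<delta>) t)"
    for t :: "('t, 'g) tensor4"
    unfolding quadadditive_def additive_iff
    by (intro conjI allI tensor_lift4_add[OF inner inner inner])
       (use assms in \<open>simp_all add: ternary_gamma_ring_def additive_iff pure_tensor_add\<close>)
  then have "F_mult op (a \<otimes>\<^sub>\<int> \<alpha> \<otimes>\<^sub>\<int> b \<otimes>\<^sub>\<int> \<beta>) (c \<otimes>\<^sub>\<int> \<gamma> \<otimes>\<^sub>\<int> d \<otimes>\<^sub>\<int> \<delta>) =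
      tensor_lift4 (\<lambda>c \<gamma> d \<delta>. op a \<alpha> b \<beta> c \<otimes>\<^sub>\<int> \<gamma> \<otimes>\<^sub>\<int> d \<otimes>\<^sub>\<int> \<delta>) (c \<otimes>\<^sub>\<int> \<gamma> \<otimes>\<^sub>\<int> d \<otimes>\<^sub>\<int> \<delta>)"
    unfolding F_mult_def by (rule tensor_lift4_pure)
  also have "\<dots> = op a \<alpha> b \<beta> c \<otimes>\<^sub>\<int> \<gamma> \<otimes>\<^sub>\<int> d \<otimes>\<^sub>\<int> \<delta>"
    by (rule tensor_lift4_pure[OF inner])
  finally show ?thesis .
qed

text \<open>
  The rngs below are stored in the library's ring records, whose \<open>one\<close> field carries no
  meaning for them. The library's \<open>ideal\<close> and \<open>genideal\<close> presuppose a unital ring, so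
  two-sided ideals of rngs are introduced separately.
\<close>

definition F_rng :: "('t::ab_group_add, 'g::ab_group_add) ternary_op \<Rightarrow> ('t, 'g) tensor4 ring" where
  "F_rng op = \<lparr>carrier = UNIV, monoid.mult = F_mult op, one = undefined, ring.zero = 0, ring.add = (+)\<rparr>"

definition two_sided_ideal :: "'a set \<Rightarrow> ('a, 'm) ring_scheme \<Rightarrow> bool" where
  "two_sided_ideal I R \<longleftrightarrow> additive_subgroup I R \<and>
     (\<forall>x\<in>carrier R. \<forall>i\<in>I. x \<otimes>\<^bsub>R\<^esub> i \<in> I \<and> i \<otimes>\<^bsub>R\<^esub> x \<in> I)"

definition generated_ideal :: "('a, 'm) ring_scheme \<Rightarrow> 'a set \<Rightarrow> 'a set" where
  "generated_ideal R S = \<Inter>{I. two_sided_ideal I R \<and> S \<subseteq> I}"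

definition operator_ideal ::
    "('t::ab_group_add, 'g::ab_group_add) ternary_op \<Rightarrow> ('t, 'g) tensor4 set" where
  "operator_ideal op = generated_ideal (F_rng op)
     {op a \<alpha> b \<beta> c \<otimes>\<^sub>\<int> \<gamma> \<otimes>\<^sub>\<int> d \<otimes>\<^sub>\<int> \<delta> - a \<otimes>\<^sub>\<int> \<alpha> \<otimes>\<^sub>\<int> op b \<beta> c \<gamma> d \<otimes>\<^sub>\<int> \<delta> | a \<alpha> b \<beta> c \<gamma> d \<delta>. True}"

definition operator_rng ::
    "('t::ab_group_add, 'g::ab_group_add) ternary_op \<Rightarrow> ('t, 'g) tensor4 set ring" where
  "operator_rng op = F_rng op Quot operator_ideal op"

definition operator_class ::
    "('t::ab_group_add, 'g::ab_group_add) ternary_op \<Rightarrow> ('t, 'g) tensor4 \<Rightarrow> ('t, 'g) tensor4 set" where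
  "operator_class op t = operator_ideal op +>\<^bsub>F_rng op\<^esub> t"

definition unital_operator_ring ::
    "('t::ab_group_add, 'g::ab_group_add) ternary_op \<Rightarrow> (int \<times> ('t, 'g) tensor4 set) ring" where
  "unital_operator_ring op =
     (let R = operator_rng op in
      \<lparr>carrier = UNIV \<times> carrier R,
       monoid.mult = (\<lambda>(n, r) (m, s). (n * m, add_pow R n s \<oplus>\<^bsub>R\<^esub> add_pow R m r \<oplus>\<^bsub>R\<^esub> r \<otimes>\<^bsub>R\<^esub> s)),
       one = (1, \<zero>\<^bsub>R\<^esub>),
       ring.zero = (0, \<zero>\<^bsub>R\<^esub>),
       ring.add = (\<lambda>(n, r) (m, s). (n + m, r \<oplus>\<^bsub>R\<^esub> s))\<rparr>)"


section \<open>The regular representation\<close>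

definition End_ring :: "('t::ab_group_add \<Rightarrow> 't) ring" where
  "End_ring = \<lparr>carrier = {f. additive f}, monoid.mult = (\<circ>), one = id,
     ring.zero = (\<lambda>_. 0), ring.add = (\<lambda>f g x. f x + g x)\<rparr>"

text \<open>
  \<open>the_elem (h ` X)\<close> is the common value of \<open>h\<close> on the coset \<open>X\<close>.
\<close>

definition regular_rep ::
    "('t::ab_group_add, 'g::ab_group_add) ternary_op \<Rightarrow> ('t, 'g) tensor4 set \<Rightarrow> 't \<Rightarrow> 't" where
  "regular_rep op X = (\<lambda>x. the_elem (tensor_lift4 (\<lambda>a \<alpha> b \<beta>. op a \<alpha> b \<beta> x) ` X))"

definition unital_regular_rep ::
    "('t::ab_group_add, 'g::ab_group_add) ternary_op \<Rightarrow> int \<times> ('t, 'g) tensor4 set \<Rightarrow> 't \<Rightarrow> 't" where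
  "unital_regular_rep op = (\<lambda>(n, u). add_pow End_ring n id \<oplus>\<^bsub>End_ring\<^esub> regular_rep op u)"

definition defect ::
    "('t::ab_group_add, 'g::ab_group_add) ternary_op \<Rightarrow> ('t, 'g) tensor4 set set" where
  "defect op = a_kernel (operator_rng op) End_ring (regular_rep op)"

definition unital_defect ::
    "('t::ab_group_add, 'g::ab_group_add) ternary_op \<Rightarrow> (int \<times> ('t, 'g) tensor4 set) set" where
  "unital_defect op = a_kernel (unital_operator_ring op) End_ring (unital_regular_rep op)"

definition regular_image ::
    "('t::ab_group_add, 'g::ab_group_add) ternary_op \<Rightarrow> ('t \<Rightarrow> 't) ring" where
  "regular_image op =
     End_ring\<lparr>carrier := unital_regular_rep op ` carrier (unital_operator_ring op)\<rparr>"

definition additive_subgroup_of :: "('a, 'm) ring_scheme \<Rightarrow> 'a set \<Rightarrow> 'a monoid" where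
  "additive_subgroup_of R H = \<lparr>carrier = H, monoid.mult = ring.add R, one = ring.zero R\<rparr>"

definition defect_square ::
    "('t::ab_group_add, 'g::ab_group_add) ternary_op \<Rightarrow> (int \<times> ('t, 'g) tensor4 set) set" where
  "defect_square op = unital_defect op \<cdot>\<^bsub>unital_operator_ring op\<^esub> unital_defect op"

definition conormal ::
    "('t::ab_group_add, 'g::ab_group_add) ternary_op \<Rightarrow> (int \<times> ('t, 'g) tensor4 set) set monoid" where
  "conormal op =
     additive_subgroup_of (unital_operator_ring op) (unital_defect op) Mod defect_square op"


section \<open>Square-zero extensions\<close>

definition square_zero_extension ::
    "'a set \<Rightarrow> ('a, 'm) ring_scheme \<Rightarrow> ('b, 'n) ring_scheme \<Rightarrow> ('a \<Rightarrow> 'b) \<Rightarrow> bool" where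
  "square_zero_extension K A R \<pi> \<longleftrightarrow>
     ring A \<and> ring R \<and> \<pi> \<in> ring_hom A R \<and> \<pi> ` carrier A = carrier R \<and>
     a_kernel A R \<pi> = K \<and> K \<cdot>\<^bsub>A\<^esub> K = {\<zero>\<^bsub>A\<^esub>}"

definition has_unital_ring_section ::
    "('a, 'm) ring_scheme \<Rightarrow> ('b, 'n) ring_scheme \<Rightarrow> ('a \<Rightarrow> 'b) \<Rightarrow> bool" where
  "has_unital_ring_section A R \<pi> \<longleftrightarrow> (\<exists>s\<in>ring_hom R A. \<forall>r\<in>carrier R. \<pi> (s r) = r)"


section \<open>Two-step ternary rings\<close>

text \<open>The power operation of \<open>additive_group\<close> is integer scaling.\<close>

definition two_step_op :: "('e::ab_group_add \<otimes>\<^sub>\<int> 'e \<otimes>\<^sub>\<int> 'e \<Rightarrow> 'w::ab_group_add)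
    \<Rightarrow> ('e \<times> 'w, int) ternary_op" where
  "two_step_op \<mu> = (\<lambda>(x, u) n (y, v) m (z, w).
     (0, \<mu> (x \<otimes>\<^sub>\<int> y \<otimes>\<^sub>\<int> z) [^]\<^bsub>additive_group\<^esub> (n * m)))"

lemma int_pow_additive_group_int: "(k::int) [^]\<^bsub>additive_group\<^esub> (n::int) = n * k"
proof -
  have nat: "k [^]\<^bsub>additive_group\<^esub> (i::nat) = int i * k" for i
    by (induction i) (auto simp: additive_group_def algebra_simps)
  have inv: "inv\<^bsub>additive_group\<^esub> x = - x" for x :: int
    by (rule group.inv_equality[OF comm_group.axioms(2)[OF comm_group_additive_group]])
       (auto simp: additive_group_def)
  show ?thesis by (simp add: int_pow_def2 nat inv)
qed

lemma ternary_gamma_ring_two_step_op: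
  assumes "additive \<mu>"
  shows "ternary_gamma_ring (two_step_op \<mu>)"
proof -
  interpret G: comm_group "additive_group :: 'b monoid"
    by (rule comm_group_additive_group)
  have add: "(u + v) [^]\<^bsub>additive_group\<^esub> n =
      u [^]\<^bsub>additive_group\<^esub> n + v [^]\<^bsub>additive_group\<^esub> n" for u v :: 'b and n :: int
    using G.int_pow_distrib[of u v n] by (simp add: additive_group_def)
  have add': "u [^]\<^bsub>additive_group\<^esub> (n + m) =
      u [^]\<^bsub>additive_group\<^esub> n + u [^]\<^bsub>additive_group\<^esub> m" for u :: 'b and n m :: int
    using G.int_pow_mult[of u n m] by (simp add: additive_group_def)
  have zero: "(0::'b) [^]\<^bsub>additive_group\<^esub> n = 0" for n :: int
    using G.int_pow_one[of n] by (simp add: additive_group_def)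
  show ?thesis
    using assms additive.zero[OF assms]
    by (auto simp: ternary_gamma_ring_def two_step_op_def additive_iff pure_tensor_add
        add add' zero distrib_left distrib_right split: prod.splits)
qed

definition two_step_B :: "('e::ab_group_add \<otimes>\<^sub>\<int> 'e \<otimes>\<^sub>\<int> 'e \<Rightarrow> 'w::ab_group_add)
    \<Rightarrow> 'e \<otimes>\<^sub>\<int> 'e \<otimes>\<^sub>\<int> 'e \<otimes>\<^sub>\<int> 'e \<Rightarrow> ('w \<otimes>\<^sub>\<int> 'e) \<times> ('e \<otimes>\<^sub>\<int> 'w)" where
  "two_step_B \<mu> = tensor_lift4 (\<lambda>a b c d.
     (\<mu> (a \<otimes>\<^sub>\<int> b \<otimes>\<^sub>\<int> c) \<otimes>\<^sub>\<int> d, - (a \<otimes>\<^sub>\<int> \<mu> (b \<otimes>\<^sub>\<int> c \<otimes>\<^sub>\<int> d))))"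

definition two_step_Q :: "('e::ab_group_add \<otimes>\<^sub>\<int> 'e \<otimes>\<^sub>\<int> 'e \<Rightarrow> 'w::ab_group_add)
    \<Rightarrow> (('w \<otimes>\<^sub>\<int> 'e) \<times> ('e \<otimes>\<^sub>\<int> 'w)) set monoid" where
  "two_step_Q \<mu> = additive_group Mod range (two_step_B \<mu>)"

text \<open>
  The maps that take classes in the operator rng, with \<open>T \<otimes> \<int> \<otimes> T \<otimes> \<int>\<close> identified with
  \<open>T \<otimes> T\<close> by inserting the unit of the integers, and the map from the direct sum of
  \<open>E \<otimes> E\<close> and \<open>Q\<close> they induce. Since \<open>W \<otimes> W\<close> is not in the source, the last map can only be
  onto if the classes of \<open>W \<otimes> W\<close> vanish, as they do when \<open>\<mu>\<close> is onto \<open>W\<close>.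
\<close>

definition class_EE :: "('e::ab_group_add \<otimes>\<^sub>\<int> 'e \<otimes>\<^sub>\<int> 'e \<Rightarrow> 'w::ab_group_add)
    \<Rightarrow> 'e \<otimes>\<^sub>\<int> 'e \<Rightarrow> ('e \<times> 'w, int) tensor4 set" where
  "class_EE \<mu> t = operator_class (two_step_op \<mu>)
     (tensor_lift (\<lambda>x y. (x, 0) \<otimes>\<^sub>\<int> 1 \<otimes>\<^sub>\<int> (y, 0) \<otimes>\<^sub>\<int> 1) t)"

definition class_WE_EW :: "('e::ab_group_add \<otimes>\<^sub>\<int> 'e \<otimes>\<^sub>\<int> 'e \<Rightarrow> 'w::ab_group_add)
    \<Rightarrow> ('w \<otimes>\<^sub>\<int> 'e) \<times> ('e \<otimes>\<^sub>\<int> 'w) \<Rightarrow> ('e \<times> 'w, int) tensor4 set" where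
  "class_WE_EW \<mu> = (\<lambda>(s, t). operator_class (two_step_op \<mu>)
     (tensor_lift (\<lambda>w y. (0, w) \<otimes>\<^sub>\<int> 1 \<otimes>\<^sub>\<int> (y, 0) \<otimes>\<^sub>\<int> 1) s +
      tensor_lift (\<lambda>x w. (x, 0) \<otimes>\<^sub>\<int> 1 \<otimes>\<^sub>\<int> (0, w) \<otimes>\<^sub>\<int> 1) t))"

definition class_Q :: "('e::ab_group_add \<otimes>\<^sub>\<int> 'e \<otimes>\<^sub>\<int> 'e \<Rightarrow> 'w::ab_group_add)
    \<Rightarrow> (('w \<otimes>\<^sub>\<int> 'e) \<times> ('e \<otimes>\<^sub>\<int> 'w)) set \<Rightarrow> ('e \<times> 'w, int) tensor4 set" where
  "class_Q \<mu> X = the_elem (class_WE_EW \<mu> ` X)"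

definition two_step_identification ::
    "('e::ab_group_add \<otimes>\<^sub>\<int> 'e \<otimes>\<^sub>\<int> 'e \<Rightarrow> 'w::ab_group_add)
    \<Rightarrow> ('e \<otimes>\<^sub>\<int> 'e) \<times> (('w \<otimes>\<^sub>\<int> 'e) \<times> ('e \<otimes>\<^sub>\<int> 'w)) set
    \<Rightarrow> ('e \<times> 'w, int) tensor4 set" where
  "two_step_identification \<mu> =
     (\<lambda>(t, X). class_EE \<mu> t \<oplus>\<^bsub>operator_rng (two_step_op \<mu>)\<^esub> class_Q \<mu> X)"

definition e_basis :: "nat \<Rightarrow> int \<times> int" where
  "e_basis i = (if i = 1 then (1, 0) else (0, 1))"

end

theory Submission
  imports Defs "HOL-Library.Z2"
begin

text \<open>
  Write \<open>T \<otimes> \<int> \<otimes> T \<otimes> \<int>\<close> in the standard bases of \<open>E\<close> and \<open>W\<close>. Modulo the relations of the operator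
  rng, all four of \<open>f \<otimes> e\<^sub>i\<close> and \<open>e\<^sub>i \<otimes> f\<close> become equal, the minus sign in \<open>\<mu>\<close> makes their common
  class \<open>q\<close> 2-torsion, and \<open>f \<otimes> f\<close> vanishes. Hence the ideal is exactly the kernel of the additive map
  that records the coefficients \<open>p\<close> of the \<open>e\<^sub>i \<otimes> e\<^sub>j\<close> together with the parity of the sum of the
  remaining coefficients, and the operator rng becomes \<open>\<int>\<^sup>4 \<times> \<int>/2\<close> with product
  \<open>(0, S p * S p')\<close>, where \<open>S\<close> is the sum of the coordinates. The element \<open>(p, c)\<close> acts on \<open>E\<close>
  by \<open>x \<mapsto> S p * (x\<^sub>1 + x\<^sub>2) - 2 * p\<^sub>2\<^sub>2 * x\<^sub>2\<close>, so the defect is given by \<open>S p = 0\<close> and \<open>p\<^sub>2\<^sub>2 = 0\<close>.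
\<close>

text \<open>\<open>bit\<close> serves as the field with two elements, so its sums and products have
  to stay in ring form for the additivity facts to match, instead of turning into bitwise
  operations.\<close>

declare add_bit_eq_xor [simp del] mult_bit_eq_and [simp del] uminus_bit_def [simp del]

section \<open>Generating sets and tensor products\<close>

text \<open>A predicate containing 0 and closed under differences is a subgroup, so this says that
  \<open>B\<close> generates the group. Stated over predicates, it is directly an induction
  rule.\<close>

definition generating :: "'a::ab_group_add set \<Rightarrow> bool" where
  "generating B \<longleftrightarrow>
     (\<forall>P. P 0 \<longrightarrow> (\<forall>x y. P x \<longrightarrow> P y \<longrightarrow> P (x - y)) \<longrightarrow> (\<forall>b\<in>B. P b) \<longrightarrow> (\<forall>x. P x))"

lemma generatingI:
  assumes "\<And>P x. P 0 \<Longrightarrow> (\<And>x y. P x \<Longrightarrow> P y \<Longrightarrow> P (x - y)) \<Longrightarrow> (\<And>b. b \<in> B \<Longrightarrow> P b) \<Longrightarrow> P x"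
  shows "generating B"
  unfolding generating_def using assms by blast

lemma generating_induct [consumes 1, case_names zero diff base]:
  assumes "generating B" "P 0" "\<And>x y. P x \<Longrightarrow> P y \<Longrightarrow> P (x - y)" "\<And>b. b \<in> B \<Longrightarrow> P b"
  shows "P x"
  using assms unfolding generating_def by blast

lemma generating_additive_eq:
  assumes "generating B" "additive f" "additive g" "\<And>b. b \<in> B \<Longrightarrow> f b = g b"
  shows "f x = g x"
  using assms(1)
  by (induction x rule: generating_induct)
     (simp_all add: additive.zero additive.diff assms)

lemma generating_int: "generating {1::int}"
proof (rule generatingI)
  fix P :: "int \<Rightarrow> bool" and x
  assume P: "P 0" "\<And>x y. P x \<Longrightarrow> P y \<Longrightarrow> P (x - y)" "\<And>b. b \<in> {1} \<Longrightarrow> P b"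
  \<comment> \<open>Only differences are available, so the upward step adds 1 by subtracting
    -1.\<close>
  have m1: "P (- 1)" using P(2)[of 0 1] P(1,3) by simp
  show "P x"
  proof (induction x rule: int_induct[of _ 0])
    case (step1 i)
    then show ?case using P(2)[of i "- 1"] m1 by simp
  next
    case (step2 i)
    then show ?case using P(2)[of i 1] P(3) by simp
  qed (rule P(1))
qed

lemma generating_prod:
  fixes A :: "'a::ab_group_add set" and B :: "'b::ab_group_add set"
  assumes "generating A" "generating B"
  shows "generating ((\<lambda>a. (a, 0)) ` A \<union> (\<lambda>b. (0, b)) ` B)"
proof (rule generatingI)
  fix P :: "'a \<times> 'b \<Rightarrow> bool" and x :: "'a \<times> 'b"
  assume P: "P 0" "\<And>x y. P x \<Longrightarrow> P y \<Longrightarrow> P (x - y)"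
    "\<And>b. b \<in> (\<lambda>a. (a, 0)) ` A \<union> (\<lambda>b. (0, b)) ` B \<Longrightarrow> P b"
  obtain a b where x: "x = (a, b)" by fastforce
  have a: "P (a, 0)" for a
    using assms(1)
  proof (induction a rule: generating_induct)
    case (diff x y)
    then show ?case using P(2)[of "(x, 0)" "(y, 0)"] by simp
  qed (use P in \<open>auto simp: zero_prod_def\<close>)
  have b: "P (0, b)" for b
    using assms(2)
  proof (induction b rule: generating_induct)
    case (diff x y)
    then show ?case using P(2)[of "(0, x)" "(0, y)"] by simp
  qed (use P in \<open>auto simp: zero_prod_def\<close>)
  \<comment> \<open>The pair is recovered as \<open>(a, b) = (a, 0) - (0, - b)\<close>.\<close>
  have "P (0, - b)" using b .
  from P(2)[OF a[of a] this] show "P x" by (simp add: x)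
qed

lemma generating_tensor:
  fixes A :: "'a::ab_group_add set" and B :: "'b::ab_group_add set"
  assumes "generating A" "generating B"
  shows "generating {a \<otimes>\<^sub>\<int> b | a b. a \<in> A \<and> b \<in> B}"
proof (rule generatingI)
  fix P :: "'a \<otimes>\<^sub>\<int> 'b \<Rightarrow> bool" and x
  assume P: "P 0" "\<And>x y. P x \<Longrightarrow> P y \<Longrightarrow> P (x - y)"
    "\<And>b. b \<in> {a \<otimes>\<^sub>\<int> b | a b. a \<in> A \<and> b \<in> B} \<Longrightarrow> P b"
  show "P x"
  proof (induction x rule: tensor_induct)
    case (pure a b)
    show ?case
      using assms(1)
    proof (induction a rule: generating_induct)
      case (base a)
      note a = base
      show ?case
        using assms(2)
      proof (induction b rule: generating_induct)
        case (base b)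
        then show ?case using a P(3) by blast
      qed (simp_all add: P pure_tensor_diff)
    qed (use P in \<open>auto simp: pure_tensor_diff\<close>)
  qed (use P in auto)
qed

lemma tensor4_induct [case_names zero pure diff]:
  fixes t :: "'a::ab_group_add \<otimes>\<^sub>\<int> 'b::ab_group_add \<otimes>\<^sub>\<int> 'c::ab_group_add \<otimes>\<^sub>\<int> 'd::ab_group_add"
  assumes "P 0" and "\<And>a b c d. P (a \<otimes>\<^sub>\<int> b \<otimes>\<^sub>\<int> c \<otimes>\<^sub>\<int> d)" and "\<And>s t. P s \<Longrightarrow> P t \<Longrightarrow> P (s - t)"
  shows "P t"
proof (induction t rule: tensor_induct)
  case (pure a s)
  show ?case
  proof (induction s rule: tensor_induct)
    case (pure b s)
    show ?case
      by (induction s rule: tensor_induct) (simp_all add: assms pure_tensor_diff)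
  qed (simp_all add: assms pure_tensor_diff)
qed (simp_all add: assms)

lemma tensor4_additive_eq:
  fixes t :: "'a::ab_group_add \<otimes>\<^sub>\<int> 'b::ab_group_add \<otimes>\<^sub>\<int> 'c::ab_group_add \<otimes>\<^sub>\<int> 'd::ab_group_add"
  assumes "additive f" "additive g"
    and "\<And>a b c d. f (a \<otimes>\<^sub>\<int> b \<otimes>\<^sub>\<int> c \<otimes>\<^sub>\<int> d) = g (a \<otimes>\<^sub>\<int> b \<otimes>\<^sub>\<int> c \<otimes>\<^sub>\<int> d)"
  shows "f t = g t"
  by (induction t rule: tensor4_induct) (simp_all add: additive.zero additive.diff assms)


section \<open>Groups and quotients of the additive group of a type\<close>

lemma additive_group_simps [simp]:
  "carrier additive_group = UNIV" "x \<otimes>\<^bsub>additive_group\<^esub> y = x + y" "\<one>\<^bsub>additive_group\<^esub> = 0"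
  by (simp_all add: additive_group_def)

lemma group_additive_group: "group additive_group"
  by (rule comm_group.axioms(2)[OF comm_group_additive_group])

lemma inv_additive_group [simp]: "inv\<^bsub>additive_group\<^esub> x = - x"
  by (rule group.inv_equality[OF group_additive_group]) simp_all

lemma hom_additive_group: "f \<in> hom additive_group additive_group \<longleftrightarrow> additive f"
  by (simp add: hom_def additive_iff)

abbreviation int_scale :: "int \<Rightarrow> 'a::ab_group_add \<Rightarrow> 'a" where
  "int_scale n x \<equiv> x [^]\<^bsub>additive_group\<^esub> n"

lemma additive_int_scale:
  assumes "additive f"
  shows "f (int_scale n x) = int_scale n (f x)"
  using assms by (intro hom_int_pow group_additive_group) (simp_all add: hom_additive_group)

lemma int_scale_add: "int_scale n (x + y) = int_scale n x + int_scale n y"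
  using comm_group.int_pow_distrib[OF comm_group_additive_group, of x y n] by simp

lemma int_scale_add_left: "int_scale (n + m) x = int_scale n x + int_scale m x"
  using group.int_pow_mult[OF group_additive_group, of x n m] by simp

lemma int_scale_int_scale: "int_scale n (int_scale m x) = int_scale (n * m) x"
  using group.int_pow_pow[OF group_additive_group, of x m n] by (simp add: mult.commute)

lemma int_scale_one: "int_scale 1 x = x"
  using group.int_pow_1[OF group_additive_group, of x] by simp

lemma int_scale_zero_left: "int_scale 0 x = 0"
  by (simp add: int_pow_def2)

lemma int_scale_zero: "int_scale n 0 = 0"
  using group.int_pow_one[OF group_additive_group, of n] by simp

lemma fst_int_scale [simp]: "fst (int_scale n x) = int_scale n (fst x)"
  by (rule additive_int_scale) (simp add: additive_iff)

lemma snd_int_scale [simp]: "snd (int_scale n x) = int_scale n (snd x)"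
  by (rule additive_int_scale) (simp add: additive_iff)

lemma int_scale_prod: "int_scale n (a, b) = (int_scale n a, int_scale n b)"
  by (simp add: prod_eq_iff)

lemmas int_scale_simps = int_scale_add int_scale_add_left int_scale_int_scale int_scale_one
  int_scale_zero_left int_scale_zero int_pow_additive_group_int

lemma r_coset_kernel_additive_group:
  assumes "additive f"
  shows "(f -` {0}) #>\<^bsub>additive_group\<^esub> x = f -` {f x}"
proof -
  have "\<exists>h\<in>f -` {0}. y = h + x" if "f y = f x" for y
    by (rule bexI[of _ "y - x"]) (simp_all add: additive.diff[OF assms] that)
  then show ?thesis by (auto simp: r_coset_def additive.add[OF assms])
qed

text \<open>Surjectivity supplies some \<open>x\<close> over \<open>a\<close>; then any
  \<open>y\<close> over \<open>a + b\<close> splits as \<open>x + (y - x)\<close>.\<close>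

lemma set_mult_fibre_additive_group:
  assumes "additive f" "surj f"
  shows "(f -` {a}) <#>\<^bsub>additive_group\<^esub> (f -` {b}) = f -` {a + b}"
proof -
  obtain x where x: "f x = a" using \<open>surj f\<close> by (metis surjD)
  have "\<exists>u\<in>f -` {a}. \<exists>v\<in>f -` {b}. y = u + v" if "f y = a + b" for y
    by (rule bexI[of _ x], rule bexI[of _ "y - x"])
       (simp_all add: additive.diff[OF assms(1)] that x)
  then show ?thesis by (auto simp: set_mult_def additive.add[OF assms(1)])
qed

text \<open>This evaluates the maps on cosets that are defined through \<open>the_elem\<close>: a
  map factoring through \<open>f\<close> is constant on each fibre, and surjectivity makes the fibre
  nonempty.\<close>

lemma the_elem_image_fibre:
  assumes "surj f" "\<And>x. g x = h (f x)"
  shows "the_elem (g ` (f -` {a})) = h a"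
proof -
  obtain x where "f x = a" using \<open>surj f\<close> by (metis surjD)
  then have "g ` (f -` {a}) = {h a}" by (auto simp: assms(2))
  then show ?thesis by simp
qed

lemma inj_fibre:
  assumes "surj f"
  shows "inj (\<lambda>a. f -` {a})"
  using assms by (metis (mono_tags, lifting) injI surjD vimage_singleton_eq)

lemma rcosets_kernel_additive_group:
  assumes "additive f" "surj f"
  shows "rcosets\<^bsub>additive_group\<^esub> (f -` {0}) = range (\<lambda>a. f -` {a})"
proof -
  have "\<exists>x. f -` {a} = f -` {f x}" for a
    using \<open>surj f\<close> by (metis surjD)
  then show ?thesis
    by (auto simp: RCOSETS_def r_coset_kernel_additive_group[OF assms(1)])
qed

text \<open>The first isomorphism theorem with the inverse map made explicit. It labels the elements
  of a quotient by the values of \<open>f\<close>, and both the operator rng and Q are computed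
  through such labels.\<close>

lemma
  fixes f :: "'a::ab_group_add \<Rightarrow> 'b::ab_group_add"
  assumes "additive f" "surj f"
  shows group_Mod_kernel: "group (additive_group Mod f -` {0})"
    and fibre_iso: "(\<lambda>a. f -` {a}) \<in> iso additive_group (additive_group Mod f -` {0})"
proof -
  have "group_hom (additive_group :: 'a monoid) (additive_group :: 'b monoid) f"
    by (simp add: group_hom_def group_hom_axioms_def group_additive_group hom_additive_group assms)
  then have "(f -` {0}) \<lhd> additive_group"
    using group_hom.normal_kernel by (simp add: kernel_def vimage_def) fastforce
  then show "group (additive_group Mod f -` {0})"
    by (rule normal.factorgroup_is_group)
  show "(\<lambda>a. f -` {a}) \<in> iso additive_group (additive_group Mod f -` {0})"
    by (rule isoI)
       (use inj_fibre[OF assms(2)] in \<open>auto simp: hom_def FactGroup_def bij_betw_def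
         rcosets_kernel_additive_group[OF assms] set_mult_fibre_additive_group[OF assms]\<close>)
qed

section \<open>Integers modulo 2 as the type \<open>bit\<close>\<close>

lemma even_iff_of_int_bit: "(of_int n :: bit) = 0 \<longleftrightarrow> even n"
proof (cases "even n")
  case True
  then obtain k where "n = 2 * k" by blast
  then show ?thesis by simp
next
  case False
  then obtain k where "n = 2 * k + 1" using oddE by blast
  then show ?thesis using False by simp
qed

lemma of_int_bit_eq_iff: "(of_int m :: bit) = of_int n \<longleftrightarrow> even (m - n)"
  by (metis eq_iff_diff_eq_0 even_iff_of_int_bit of_int_diff)

lemma surj_of_int_bit: "surj (of_int :: int \<Rightarrow> bit)"
proof (rule surjI)
  show "of_int (if b = 0 then 0 else 1) = b" for b :: bit by (cases b) auto
qed

lemma of_int_mod_2_bit: "(of_int (n mod 2) :: bit) = of_int n"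
  by (simp add: of_int_bit_eq_iff)

lemma bij_betw_of_int_bit: "bij_betw (of_int :: int \<Rightarrow> bit) {0..<2} UNIV"
proof (rule bij_betw_imageI)
  show "inj_on (of_int :: int \<Rightarrow> bit) {0..<2}"
    by (rule inj_onI) (simp add: of_int_bit_eq_iff, presburger)
  show "of_int ` {0..<2} = (UNIV :: bit set)"
  proof -
    have "\<exists>n\<in>{0..<2}. b = of_int n" for b :: bit
    proof -
      obtain n where "b = of_int n" using surj_of_int_bit by (metis surjD)
      then show ?thesis by (intro bexI[of _ "n mod 2"]) (simp_all add: of_int_mod_2_bit)
    qed
    then show ?thesis by auto
  qed
qed

section \<open>The operator rng in coordinates\<close>

text \<open>Additivity in each factor allows identities about products to be checked on pure
  tensors.\<close>

lemma
  fixes op :: "('t::ab_group_add, 'g::ab_group_add) ternary_op"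
  assumes "ternary_gamma_ring op"
  shows additive_F_mult_left: "additive (\<lambda>s. F_mult op s t)"
    and additive_F_mult_right: "additive (F_mult op s)"
proof -
  have inner: "quadadditive (\<lambda>c \<gamma> d \<delta>. op a \<alpha> b \<beta> c \<otimes>\<^sub>\<int> \<gamma> \<otimes>\<^sub>\<int> d \<otimes>\<^sub>\<int> \<delta>)" for a \<alpha> b \<beta>
    using assms by (simp add: ternary_gamma_ring_def quadadditive_def additive_iff pure_tensor_add)
  have outer: "quadadditive (\<lambda>a \<alpha> b \<beta>.
      tensor_lift4 (\<lambda>c \<gamma> d \<delta>. op a \<alpha> b \<beta> c \<otimes>\<^sub>\<int> \<gamma> \<otimes>\<^sub>\<int> d \<otimes>\<^sub>\<int> \<delta>) t)"
    for t :: "('t, 'g) tensor4"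
    unfolding quadadditive_def additive_iff
    by (intro conjI allI tensor_lift4_add[OF inner inner inner])
       (use assms in \<open>simp_all add: ternary_gamma_ring_def additive_iff pure_tensor_add\<close>)
  show "additive (\<lambda>s. F_mult op s t)"
    unfolding F_mult_def by (rule additive_tensor_lift4[OF outer])
  show "additive (F_mult op s)"
    unfolding F_mult_def additive_iff
    by (intro allI tensor_lift4_add[OF outer outer outer] additive.add additive_tensor_lift4 inner)
qed

lemma add_monoid_F_rng: "add_monoid (F_rng op) = additive_group"
  by (simp add: F_rng_def additive_group_def)

text \<open>The coefficients of \<open>p\<^sub>1\<^sub>1\<close>, \<open>p\<^sub>1\<^sub>2\<close>,
  \<open>p\<^sub>2\<^sub>1\<close>, \<open>p\<^sub>2\<^sub>2\<close> in this order, grouped by the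
  first index.\<close>

type_synonym pair_coords = "(int \<times> int) \<times> (int \<times> int)"

definition coord_sum :: "pair_coords \<Rightarrow> int" where
  "coord_sum p = fst (fst p) + snd (fst p) + fst (snd p) + snd (snd p)"

definition coord_last :: "pair_coords \<Rightarrow> int" where
  "coord_last p = snd (snd p)"

lemma additive_coord_sum: "additive coord_sum" and additive_coord_last: "additive coord_last"
  by (simp_all add: additive_iff coord_sum_def coord_last_def)

text \<open>Any two basis elements \<open>p\<^sub>i\<^sub>j\<close> multiply to q up to a sign that
  2-torsion absorbs, and q itself multiplies to zero; only the coordinate sums survive.\<close>

definition coord_mult :: "pair_coords \<times> bit \<Rightarrow> pair_coords \<times> bit \<Rightarrow> pair_coords \<times> bit" where
  "coord_mult m m' = (0, of_int (coord_sum (fst m) * coord_sum (fst m')))"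

lemma coord_mult_add:
  "coord_mult (a + b) m = coord_mult a m + coord_mult b m"
  "coord_mult m (a + b) = coord_mult m a + coord_mult m b"
  by (simp_all add: coord_mult_def additive.add[OF additive_coord_sum] algebra_simps)

lemma coord_mult_zero: "coord_mult 0 m = 0" "coord_mult m 0 = 0"
  by (simp_all add: coord_mult_def coord_sum_def zero_prod_def)

lemma fst_coord_mult [simp]: "fst (coord_mult a b) = 0"
  by (simp add: coord_mult_def)

text \<open>The last entry adds up the coefficients of all four mixed generators and ignores W
  \<otimes> W. It is kept as an integer here because tensors are later compared with a lift of these
  coordinates; the parity is taken afterwards.\<close>

definition op_coords :: "((int \<times> int) \<times> int, int) tensor4 \<Rightarrow> pair_coords \<times> int" where
  "op_coords = tensor_lift4 (\<lambda>x n y m.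
     (((n * m * fst (fst x) * fst (fst y), n * m * fst (fst x) * snd (fst y)),
       (n * m * snd (fst x) * fst (fst y), n * m * snd (fst x) * snd (fst y))),
      n * m * (snd x * (fst (fst y) + snd (fst y)) + (fst (fst x) + snd (fst x)) * snd y)))"

definition op_parity :: "((int \<times> int) \<times> int, int) tensor4 \<Rightarrow> pair_coords \<times> bit" where
  "op_parity t = (fst (op_coords t), of_int (snd (op_coords t)))"

lemma additive_op_coords: "additive op_coords"
  and op_coords_pure: "op_coords (x \<otimes>\<^sub>\<int> n \<otimes>\<^sub>\<int> y \<otimes>\<^sub>\<int> m) =
    (((n * m * fst (fst x) * fst (fst y), n * m * fst (fst x) * snd (fst y)),
       (n * m * snd (fst x) * fst (fst y), n * m * snd (fst x) * snd (fst y))),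
      n * m * (snd x * (fst (fst y) + snd (fst y)) + (fst (fst x) + snd (fst x)) * snd y))"
proof -
  let ?f = "\<lambda>(x::(int \<times> int) \<times> int) n (y::(int \<times> int) \<times> int) m.
    (((n * m * fst (fst x) * fst (fst y), n * m * fst (fst x) * snd (fst y)),
       (n * m * snd (fst x) * fst (fst y), n * m * snd (fst x) * snd (fst y))),
      n * m * (snd x * (fst (fst y) + snd (fst y)) + (fst (fst x) + snd (fst x)) * snd y))"
  have "quadadditive ?f"
    unfolding quadadditive_def additive_iff by (simp add: algebra_simps)
  then show "additive op_coords" "op_coords (x \<otimes>\<^sub>\<int> n \<otimes>\<^sub>\<int> y \<otimes>\<^sub>\<int> m) = ?f x n y m"
    unfolding op_coords_def by (rule additive_tensor_lift4, rule tensor_lift4_pure)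
qed

lemma op_parity_pure: "op_parity (x \<otimes>\<^sub>\<int> n \<otimes>\<^sub>\<int> y \<otimes>\<^sub>\<int> m) =
    (((n * m * fst (fst x) * fst (fst y), n * m * fst (fst x) * snd (fst y)),
       (n * m * snd (fst x) * fst (fst y), n * m * snd (fst x) * snd (fst y))),
      of_int (n * m * (snd x * (fst (fst y) + snd (fst y)) + (fst (fst x) + snd (fst x)) * snd y)))"
  by (simp add: op_parity_def op_coords_pure)

lemma additive_op_parity: "additive op_parity"
  by (simp add: op_parity_def additive_iff additive.add[OF additive_op_coords])

text \<open>
  The coefficients sit inside tensor factors, which makes this map additive without a scalar
  multiplication on the tensor product.
\<close>

definition of_op_coords :: "pair_coords \<times> int \<Rightarrow> ((int \<times> int) \<times> int, int) tensor4" where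
  "of_op_coords m =
     ((1, 0), 0) \<otimes>\<^sub>\<int> 1 \<otimes>\<^sub>\<int> (fst (fst m), 0) \<otimes>\<^sub>\<int> 1 + ((0, 1), 0) \<otimes>\<^sub>\<int> 1 \<otimes>\<^sub>\<int> (snd (fst m), 0) \<otimes>\<^sub>\<int> 1 +
     (0, snd m) \<otimes>\<^sub>\<int> 1 \<otimes>\<^sub>\<int> ((1, 0), 0) \<otimes>\<^sub>\<int> 1"

lemma additive_of_op_coords: "additive of_op_coords"
proof -
  have *: "(a + a', 0 :: int) = (a, 0) + (a', 0)" "(0 :: int \<times> int, b + b') = (0, b) + (0, b')"
    for a a' :: "int \<times> int" and b b' :: int by simp_all
  show ?thesis
    unfolding additive_iff of_op_coords_def
    by (simp only: fst_add snd_add * pure_tensor_add) (simp add: algebra_simps)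
qed

lemma op_coords_of_op_coords: "op_coords (of_op_coords m) = m"
  by (cases m) (auto simp: of_op_coords_def additive.add[OF additive_op_coords] op_coords_pure)

lemma surj_op_parity: "surj op_parity"
proof (rule surjI)
  fix m :: "pair_coords \<times> bit"
  obtain k where "of_int k = snd m" using surj_of_int_bit by (metis surjD)
  \<comment> \<open>\<open>surjI\<close> asks for an explicit right inverse, so the integer lift of
    the bit is chosen inside it.\<close>
  then show "op_parity (of_op_coords (fst m, SOME k. of_int k = snd m)) = m"
    by (simp add: op_parity_def op_coords_of_op_coords prod_eq_iff)
       (rule someI[of _ k])
qed

abbreviation standard_E :: "(int \<times> int) set" where
  "standard_E \<equiv> {(1, 0), (0, 1)}"

lemma generating_standard_E: "generating standard_E"
  using generating_prod[OF generating_int generating_int] by (simp add: insert_commute)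

text \<open>It reduces claims about all tensors to nine pure ones, formed from
  \<open>e\<^sub>1\<close>, \<open>e\<^sub>2\<close> and f with both scalars equal to 1.\<close>

lemma generating_two_step_tensor4:
  "generating {x \<otimes>\<^sub>\<int> (1::int) \<otimes>\<^sub>\<int> y \<otimes>\<^sub>\<int> (1::int) | x y.
     x \<in> {((1::int, 0::int), 0::int), ((0, 1), 0), (0, 1)} \<and>
     y \<in> {((1::int, 0::int), 0::int), ((0, 1), 0), (0, 1)}}"
  (is "generating ?B")
proof -
  have T: "generating {((1::int, 0::int), 0::int), ((0, 1), 0), (0, 1)}"
    using generating_prod[OF generating_standard_E generating_int]
    by (simp add: insert_commute)
  have "generating {x \<otimes>\<^sub>\<int> t | x t. x \<in> {((1::int, 0::int), 0::int), ((0, 1), 0), (0, 1)} \<and>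
      t \<in> {n \<otimes>\<^sub>\<int> t | n t. n \<in> {1::int} \<and> 
      t \<in> {y \<otimes>\<^sub>\<int> m | y m. y \<in> {((1::int, 0::int), 0::int), ((0, 1), 0), (0, 1)} \<and> m \<in> {1::int}}}}"
    by (intro generating_tensor T generating_int)
  also have "\<dots> = ?B" by blast
  finally show ?thesis .
qed

section \<open>The sign tensor and its ideal of relations\<close>

locale sign_tensor =
  fixes \<mu> :: "(int \<times> int) \<otimes>\<^sub>\<int> (int \<times> int) \<otimes>\<^sub>\<int> (int \<times> int) \<Rightarrow> int"
  assumes additive_mu: "additive \<mu>"
    and mu_basis: "\<forall>i\<in>{1, 2}. \<forall>j\<in>{1, 2}. \<forall>k\<in>{1, 2}.
      \<mu> (e_basis i \<otimes>\<^sub>\<int> e_basis j \<otimes>\<^sub>\<int> e_basis k) = (if (i, j, k) = (2, 2, 2) then - 1 else 1)"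
begin

abbreviation T :: "((int \<times> int) \<times> int, int) ternary_op" where
  "T \<equiv> two_step_op \<mu>"

text \<open>The tensor is the all-ones tensor, which is the product of the three coordinate sums,
  lowered by 2 at the index (2,2,2). Modulo 2 only the product of sums remains.\<close>

lemma mu_eq:
  "\<mu> (x \<otimes>\<^sub>\<int> y \<otimes>\<^sub>\<int> z) = (fst x + snd x) * (fst y + snd y) * (fst z + snd z) - 2 * snd x * snd y * snd z"
proof -
  let ?F = "\<lambda>(x :: int \<times> int) (y :: int \<times> int) (z :: int \<times> int).
    (fst x + snd x) * (fst y + snd y) * (fst z + snd z) - 2 * snd x * snd y * snd z"
  note add_simps = additive_iff pure_tensor_add additive.add[OF additive_mu] algebra_simps
  have basis: "\<mu> (x \<otimes>\<^sub>\<int> y \<otimes>\<^sub>\<int> z) = ?F x y z"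
    if "x \<in> standard_E" "y \<in> standard_E" "z \<in> standard_E" for x y z
    using mu_basis that by (auto simp: e_basis_def)
  \<comment> \<open>The arguments are freed from the basis one at a time, last to first, by
    additivity in each.\<close>
  have 1: "\<mu> (x \<otimes>\<^sub>\<int> y \<otimes>\<^sub>\<int> z) = ?F x y z" if "x \<in> standard_E" "y \<in> standard_E" for x y z
  proof (rule generating_additive_eq[OF generating_standard_E, of _ _ z])
    show "\<mu> (x \<otimes>\<^sub>\<int> y \<otimes>\<^sub>\<int> b) = ?F x y b" if "b \<in> standard_E" for b
      by (rule basis) fact+
  qed (simp_all add: add_simps)
  have 2: "\<mu> (x \<otimes>\<^sub>\<int> y \<otimes>\<^sub>\<int> z) = ?F x y z" if "x \<in> standard_E" for x y z
  proof (rule generating_additive_eq[OF generating_standard_E, of _ _ y])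
    show "\<mu> (x \<otimes>\<^sub>\<int> b \<otimes>\<^sub>\<int> z) = ?F x b z" if "b \<in> standard_E" for b
      by (rule 1) fact+
  qed (simp_all add: add_simps)
  show ?thesis
    by (rule generating_additive_eq[OF generating_standard_E, of _ _ x])
       (rule 2 | simp add: add_simps)+
qed

lemma T_eq:
  "T x n y m z = (0, n * m * ((fst (fst x) + snd (fst x)) * (fst (fst y) + snd (fst y)) *
     (fst (fst z) + snd (fst z)) - 2 * snd (fst x) * snd (fst y) * snd (fst z)))"
  by (simp add: two_step_op_def mu_eq int_pow_additive_group_int split: prod.splits)

lemma ternary_T: "ternary_gamma_ring T"
  by (rule ternary_gamma_ring_two_step_op[OF additive_mu])

text \<open>On pure tensors the product has its first factor in W, so the E \<otimes> E coordinates
  vanish, and by \<open>mu_eq\<close> its parity is the product of the four coordinate sums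
  involved.\<close>

lemma op_parity_F_mult: "op_parity (F_mult T s t) = coord_mult (op_parity s) (op_parity t)"
proof -
  have 1: "op_parity (F_mult T (a \<otimes>\<^sub>\<int> \<alpha> \<otimes>\<^sub>\<int> b \<otimes>\<^sub>\<int> \<beta>) t) = coord_mult (op_parity (a \<otimes>\<^sub>\<int> \<alpha> \<otimes>\<^sub>\<int> b \<otimes>\<^sub>\<int> \<beta>)) (op_parity t)"
    for a \<alpha> b \<beta>
  proof (rule tensor4_additive_eq[of _ _ t])
    fix c d :: "(int \<times> int) \<times> int" and \<gamma> \<delta> :: int
    show "op_parity (F_mult T (a \<otimes>\<^sub>\<int> \<alpha> \<otimes>\<^sub>\<int> b \<otimes>\<^sub>\<int> \<beta>) (c \<otimes>\<^sub>\<int> \<gamma> \<otimes>\<^sub>\<int> d \<otimes>\<^sub>\<int> \<delta>)) =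
        coord_mult (op_parity (a \<otimes>\<^sub>\<int> \<alpha> \<otimes>\<^sub>\<int> b \<otimes>\<^sub>\<int> \<beta>)) (op_parity (c \<otimes>\<^sub>\<int> \<gamma> \<otimes>\<^sub>\<int> d \<otimes>\<^sub>\<int> \<delta>))"
      by (simp add: F_mult_pure[OF ternary_T] T_eq op_parity_def op_coords_pure coord_mult_def
          coord_sum_def zero_prod_def of_int_bit_eq_iff del: of_int_mult of_int_add of_int_diff) blast
  qed (simp_all add: additive_iff additive.add[OF additive_F_mult_right[OF ternary_T]]
      additive.add[OF additive_op_parity] coord_mult_add)
  show ?thesis
    by (rule tensor4_additive_eq[of _ _ s])
       (simp_all add: 1 additive_iff additive.add[OF additive_F_mult_left[OF ternary_T]]
      additive.add[OF additive_op_parity] coord_mult_add)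
qed

lemma two_sided_ideal_op_parity: "two_sided_ideal (op_parity -` {0}) (F_rng T)"
proof -
  have "additive_subgroup (op_parity -` {0}) (F_rng T)"
    by (rule additive_subgroup.intro, unfold add_monoid_F_rng, unfold subgroup_def)
       (simp add: additive.add[OF additive_op_parity] additive.zero[OF additive_op_parity]
         additive.minus[OF additive_op_parity])
  then show ?thesis
    by (simp add: two_sided_ideal_def F_rng_def op_parity_F_mult coord_mult_zero)
qed

text \<open>This is the minimality of the kernel. Modulo \<open>I\<close> every tensor equals the
  normal form rebuilt from its coordinates, and twice the class of a mixed generator is zero, so an
  element of the kernel reduces to zero.\<close>

lemma two_sided_ideal_contains_kernel:
  assumes I: "two_sided_ideal I (F_rng T)"
    and rel: "\<And>a \<alpha> b \<beta> c \<gamma> d \<delta>.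
      T a \<alpha> b \<beta> c \<otimes>\<^sub>\<int> \<gamma> \<otimes>\<^sub>\<int> d \<otimes>\<^sub>\<int> \<delta> - a \<otimes>\<^sub>\<int> \<alpha> \<otimes>\<^sub>\<int> T b \<beta> c \<gamma> d \<otimes>\<^sub>\<int> \<delta> \<in> I"
  shows "op_parity -` {0} \<subseteq> I"
proof -
  have sub: "subgroup I additive_group"
    using I unfolding two_sided_ideal_def additive_subgroup_def add_monoid_F_rng by blast
  have I0: "0 \<in> I" and Iadd: "x \<in> I \<Longrightarrow> y \<in> I \<Longrightarrow> x + y \<in> I" and Iminus: "x \<in> I \<Longrightarrow> - x \<in> I" for x y
    using subgroup.one_closed[OF sub] subgroup.m_closed[OF sub, of x y]
      subgroup.m_inv_closed[OF sub, of x] by simp_all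
  have Idiff: "x - y \<in> I" if "x \<in> I" "y \<in> I" for x y
    using Iadd[OF that(1) Iminus[OF that(2)]] by simp
  let ?A = "\<lambda>y. ((0, 1) \<otimes>\<^sub>\<int> 1 \<otimes>\<^sub>\<int> (y, 0) \<otimes>\<^sub>\<int> 1 :: ((int \<times> int) \<times> int, int) tensor4)"
    and ?B = "\<lambda>x. ((x, 0) \<otimes>\<^sub>\<int> 1 \<otimes>\<^sub>\<int> (0, 1) \<otimes>\<^sub>\<int> 1 :: ((int \<times> int) \<times> int, int) tensor4)"
  have zp: "(0, 0) = (0 :: 'x::zero \<times> 'y::zero)" by (simp add: zero_prod_def)
  \<comment> \<open>The relations at the indices (1,1,1,1), (1,1,1,2) and (2,1,1,1) link all four
    mixed generators.\<close>
  have r1: "?A (1, 0) - ?B (1, 0) \<in> I"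
    using rel[of "((1, 0), 0)" 1 "((1, 0), 0)" 1 "((1, 0), 0)" 1 "((1, 0), 0)" 1] by (simp add: T_eq)
  have r2: "?A (0, 1) - ?B (1, 0) \<in> I"
    using rel[of "((1, 0), 0)" 1 "((1, 0), 0)" 1 "((1, 0), 0)" 1 "((0, 1), 0)" 1] by (simp add: T_eq)
  have r3: "?A (1, 0) - ?B (0, 1) \<in> I"
    using rel[of "((0, 1), 0)" 1 "((1, 0), 0)" 1 "((1, 0), 0)" 1 "((1, 0), 0)" 1] by (simp add: T_eq)
  have neg: "(0, - 1) \<otimes>\<^sub>\<int> t = - ((0, 1) \<otimes>\<^sub>\<int> t)" for t :: "int \<otimes>\<^sub>\<int> ((int \<times> int) \<times> int) \<otimes>\<^sub>\<int> int"
    using pure_tensor_diff(1)[of 0 "(0, 1)" t] by (simp flip: zero_prod_def)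
  \<comment> \<open>At (2,2,2,1) only the first term picks up the negative entry of \<mu>. Against
    \<open>r3\<close>, this is the source of the 2-torsion.\<close>
  have r4: "- ?A (1, 0) - ?B (0, 1) \<in> I"
    using rel[of "((0, 1), 0)" 1 "((0, 1), 0)" 1 "((0, 1), 0)" 1 "((1, 0), 0)" 1] by (simp add: T_eq neg)
  \<comment> \<open>With f in the last slot the inner ternary product is zero, so the relation
    consists of f \<otimes> f alone.\<close>
  have r5: "(0, 1) \<otimes>\<^sub>\<int> 1 \<otimes>\<^sub>\<int> (0, 1) \<otimes>\<^sub>\<int> 1 \<in> I"
    using rel[of "((1, 0), 0)" 1 "((1, 0), 0)" 1 "((1, 0), 0)" 1 "(0, 1)" 1] by (simp add: T_eq zp)
  have double: "?A (1, 0) + ?A (1, 0) \<in> I"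
    using Idiff[OF r3 r4] by (simp add: algebra_simps)
  \<comment> \<open>On the nine generators the difference is 0 for E \<otimes> E, a combination of
    \<open>r1\<close>, \<open>r2\<close>, \<open>r3\<close> for the mixed ones, and
    \<open>r5\<close> for f \<otimes> f.\<close>
  have red: "t - of_op_coords (op_coords t) \<in> I" for t
    using generating_two_step_tensor4
  proof (induction t rule: generating_induct)
    case zero
    show ?case by (simp add: additive.zero[OF additive_op_coords] additive.zero[OF additive_of_op_coords] I0)
  next
    case (diff x y)
    show ?case
      using Idiff[OF diff] by (simp add: additive.diff[OF additive_op_coords] additive.diff[OF additive_of_op_coords] algebra_simps)
  next
    case (base t)
    have "?A (0, 1) - ?A (1, 0) \<in> I" using Idiff[OF r2 r1] by simp
    moreover have "?B (1, 0) - ?A (1, 0) \<in> I" using Iminus[OF r1] by simp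
    moreover have "?B (0, 1) - ?A (1, 0) \<in> I" using Iminus[OF r3] by simp
    ultimately show ?case
      using base I0 r5 by (auto simp: op_coords_pure of_op_coords_def zp)
  qed
  have even: "of_op_coords (0, 2 * k) \<in> I" for k
    using generating_int
  proof (induction k rule: generating_induct)
    case zero
    show ?case using I0 by (simp add: zp additive.zero[OF additive_of_op_coords])
  next
    case (diff x y)
    show ?case
      using Idiff[OF diff] by (simp flip: additive.diff[OF additive_of_op_coords] add: right_diff_distrib)
  next
    case (base k)
    have "of_op_coords (0, 2) = of_op_coords (0, 1) + of_op_coords (0, 1)"
      by (simp flip: additive.add[OF additive_of_op_coords])
    then show ?case using base double by (simp add: of_op_coords_def zp)
  qed
  show ?thesis
  proof
    fix t assume "t \<in> op_parity -` {0}"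
    then have "fst (op_coords t) = 0" "even (snd (op_coords t))"
      by (simp_all add: op_parity_def zero_prod_def even_iff_of_int_bit)
    then obtain k where "op_coords t = (0, 2 * k)" by (metis evenE prod.collapse)
    then show "t \<in> I" using Iadd[OF red[of t] even[of k]] by simp
  qed
qed

text \<open>A defining relation has no E \<otimes> E part, and both of its terms have as mixed
  coefficient, modulo 2, the product of the coordinate sums of its four entries. Hence the kernel
  contains the relations; the converse is the minimality above.\<close>

lemma operator_ideal_T: "operator_ideal T = op_parity -` {0}"
proof
  have "op_parity (T a \<alpha> b \<beta> c \<otimes>\<^sub>\<int> \<gamma> \<otimes>\<^sub>\<int> d \<otimes>\<^sub>\<int> \<delta> - a \<otimes>\<^sub>\<int> \<alpha> \<otimes>\<^sub>\<int> T b \<beta> c \<gamma> d \<otimes>\<^sub>\<int> \<delta>) = 0" for a \<alpha> b \<beta> c \<gamma> d \<delta>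
    by (simp add: op_parity_def additive.diff[OF additive_op_coords] op_coords_pure T_eq zero_prod_def
        even_iff_of_int_bit del: of_int_mult of_int_add of_int_diff) blast
  then show "operator_ideal T \<subseteq> op_parity -` {0}"
    unfolding operator_ideal_def generated_ideal_def
    using two_sided_ideal_op_parity by (intro Inter_lower) auto
  show "op_parity -` {0} \<subseteq> operator_ideal T"
    unfolding operator_ideal_def generated_ideal_def
  proof (rule Inter_greatest)
    fix I
    assume "I \<in> {I. two_sided_ideal I (F_rng T) \<and>
      {T a \<alpha> b \<beta> c \<otimes>\<^sub>\<int> \<gamma> \<otimes>\<^sub>\<int> d \<otimes>\<^sub>\<int> \<delta> - a \<otimes>\<^sub>\<int> \<alpha> \<otimes>\<^sub>\<int> T b \<beta> c \<gamma> d \<otimes>\<^sub>\<int> \<delta> |a \<alpha> b \<beta> c \<gamma> d \<delta>. True} \<subseteq> I}"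
    then show "op_parity -` {0} \<subseteq> I"
      by (intro two_sided_ideal_contains_kernel) blast+
  qed
qed

end

section \<open>Coordinates on E \<otimes> E and parity on the target of B\<close>

definition EE_coords :: "(int \<times> int) \<otimes>\<^sub>\<int> (int \<times> int) \<Rightarrow> pair_coords" where
  "EE_coords = tensor_lift
     (\<lambda>x y. ((fst x * fst y, fst x * snd y), (snd x * fst y, snd x * snd y)))"

lemma additive_EE_coords: "additive EE_coords"
  and EE_coords_pure:
    "EE_coords (x \<otimes>\<^sub>\<int> y) = ((fst x * fst y, fst x * snd y), (snd x * fst y, snd x * snd y))"
proof -
  have "biadditive (\<lambda>(x :: int \<times> int) (y :: int \<times> int).
      ((fst x * fst y, fst x * snd y), (snd x * fst y, snd x * snd y)))"
    by (simp add: biadditive_def additive_iff algebra_simps)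
  then show "additive EE_coords"
    "EE_coords (x \<otimes>\<^sub>\<int> y) = ((fst x * fst y, fst x * snd y), (snd x * fst y, snd x * snd y))"
    unfolding EE_coords_def by (rule additive_tensor_lift, rule tensor_lift_pure)
qed

lemma bij_EE_coords: "bij EE_coords"
proof (rule bijI')
  \<comment> \<open>The inverse map: each row of coefficients is itself a vector of E and goes into
    the second factor.\<close>
  define g :: "pair_coords \<Rightarrow> (int \<times> int) \<otimes>\<^sub>\<int> (int \<times> int)" where
    "g p = (1, 0) \<otimes>\<^sub>\<int> fst p + (0, 1) \<otimes>\<^sub>\<int> snd p" for p
  have add_g: "additive g"
    by (simp add: additive_iff g_def pure_tensor_add)
  then have "additive (\<lambda>t. g (EE_coords t))"
    unfolding additive_iff by (simp add: additive.add[OF additive_EE_coords] additive.add[OF add_g])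
  then have "g (EE_coords t) = t" for t
    by (rule generating_additive_eq[OF generating_tensor[OF generating_standard_E generating_standard_E],
          of "\<lambda>t. g (EE_coords t)" "\<lambda>t. t"])
       (auto simp: EE_coords_pure g_def additive_iff simp flip: zero_prod_def)
  then show "EE_coords s = EE_coords t \<longleftrightarrow> s = t" for s t by metis
  show "\<exists>t. p = EE_coords t" for p
    by (rule exI[of _ "g p"])
       (simp add: g_def additive.add[OF additive_EE_coords] EE_coords_pure prod_eq_iff)
qed

text \<open>The counterpart of the last entry of \<open>op_coords\<close>, again kept integral so
  that it can be lifted back.\<close>

definition WE_EW_sum :: "(int \<otimes>\<^sub>\<int> (int \<times> int)) \<times> ((int \<times> int) \<otimes>\<^sub>\<int> int) \<Rightarrow> int" where
  "WE_EW_sum z = tensor_lift (\<lambda>w y. w * (fst y + snd y)) (fst z) +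
     tensor_lift (\<lambda>x w. (fst x + snd x) * w) (snd z)"

definition WE_EW_parity :: "(int \<otimes>\<^sub>\<int> (int \<times> int)) \<times> ((int \<times> int) \<otimes>\<^sub>\<int> int) \<Rightarrow> bit" where
  "WE_EW_parity z = of_int (WE_EW_sum z)"

lemma additive_WE_EW_sum: "additive WE_EW_sum"
  and WE_EW_sum_WE: "WE_EW_sum (w \<otimes>\<^sub>\<int> y, 0) = w * (fst y + snd y)"
  and WE_EW_sum_EW: "WE_EW_sum (0, x \<otimes>\<^sub>\<int> w) = (fst x + snd x) * w"
proof -
  have 1: "biadditive (\<lambda>(w::int) y. w * (fst y + snd y))"
    by (simp add: biadditive_def additive_iff algebra_simps)
  have 2: "biadditive (\<lambda>x (w::int). (fst x + snd x) * w)"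
    by (simp add: biadditive_def additive_iff algebra_simps)
  note lift = additive_tensor_lift[OF 1] additive_tensor_lift[OF 2]
  show "additive WE_EW_sum" "WE_EW_sum (w \<otimes>\<^sub>\<int> y, 0) = w * (fst y + snd y)"
    "WE_EW_sum (0, x \<otimes>\<^sub>\<int> w) = (fst x + snd x) * w"
    by (simp_all add: additive_iff WE_EW_sum_def lift[THEN additive.add] lift[THEN additive.zero]
        tensor_lift_pure[OF 1] tensor_lift_pure[OF 2])
qed

lemma additive_WE_EW_parity: "additive WE_EW_parity"
  by (simp add: additive_iff WE_EW_parity_def additive.add[OF additive_WE_EW_sum])

lemma surj_WE_EW_parity: "surj WE_EW_parity"
proof -
  have "\<exists>z. b = WE_EW_parity z" for b
  proof -
    obtain k where "b = of_int k" using surj_of_int_bit by (metis surjD)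
    then have "b = WE_EW_parity (k \<otimes>\<^sub>\<int> (1, 0), 0)" by (simp add: WE_EW_parity_def WE_EW_sum_WE)
    then show ?thesis ..
  qed
  then show ?thesis by auto
qed

lemma generating_WE_EW:
  "generating {((1::int) \<otimes>\<^sub>\<int> (1::int, 0::int), 0), (1 \<otimes>\<^sub>\<int> (0, 1), 0),
     (0, (1::int, 0::int) \<otimes>\<^sub>\<int> (1::int)), (0, (0, 1) \<otimes>\<^sub>\<int> 1)}"
  (is "generating ?B")
proof -
  have "generating ((\<lambda>a. (a, 0)) ` {a \<otimes>\<^sub>\<int> b | a b. a \<in> {1::int} \<and> b \<in> standard_E} \<union>
      (\<lambda>b. (0, b)) ` {a \<otimes>\<^sub>\<int> b | a b. a \<in> standard_E \<and> b \<in> {1::int}})"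
    by (intro generating_prod generating_tensor generating_standard_E generating_int)
  also have "\<dots> = ?B" by blast
  finally show ?thesis .
qed

section \<open>The operator rng, Q and their identification in coordinates\<close>

context sign_tensor
begin

text \<open>Cosets of the operator ideal are exactly these fibres, so \<open>m\<close> serves as the
  name of a class.\<close>

definition op_fibre :: "pair_coords \<times> bit \<Rightarrow> ((int \<times> int) \<times> int, int) tensor4 set" where
  "op_fibre m = op_parity -` {m}"

lemma op_fibre_eq_iff [simp]: "op_fibre m = op_fibre m' \<longleftrightarrow> m = m'"
  unfolding op_fibre_def using inj_fibre[OF surj_op_parity] by (rule inj_eq)

lemma a_r_coset_F_rng: "operator_ideal T +>\<^bsub>F_rng T\<^esub> t = op_fibre (op_parity t)"
  by (simp only: a_r_coset_def add_monoid_F_rng operator_ideal_T op_fibre_def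
      r_coset_kernel_additive_group[OF additive_op_parity])

lemma operator_class_T: "operator_class T t = op_fibre (op_parity t)"
  by (simp add: operator_class_def a_r_coset_F_rng)

lemma add_monoid_operator_rng: "add_monoid (operator_rng T) = additive_group Mod op_parity -` {0}"
  by (simp add: operator_rng_def FactRing_def A_RCOSETS_def set_add_def FactGroup_def
      operator_ideal_T flip: add_monoid_F_rng[of T])

lemma op_fibre_iso: "op_fibre \<in> iso additive_group (add_monoid (operator_rng T))"
  unfolding add_monoid_operator_rng op_fibre_def[abs_def]
  by (rule fibre_iso[OF additive_op_parity surj_op_parity])

lemma group_add_operator_rng: "group (add_monoid (operator_rng T))"
  unfolding add_monoid_operator_rng by (rule group_Mod_kernel[OF additive_op_parity surj_op_parity])

lemma carrier_operator_rng: "carrier (operator_rng T) = range op_fibre"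
  using op_fibre_iso by (simp add: iso_def bij_betw_def)

lemma add_operator_rng [simp]: "op_fibre a \<oplus>\<^bsub>operator_rng T\<^esub> op_fibre b = op_fibre (a + b)"
  using op_fibre_iso hom_mult[of op_fibre additive_group "add_monoid (operator_rng T)" a b]
  by (simp add: iso_def)

lemma zero_operator_rng [simp]: "\<zero>\<^bsub>operator_rng T\<^esub> = op_fibre 0"
  by (simp add: operator_rng_def FactRing_def operator_ideal_T op_fibre_def)

lemma add_pow_operator_rng [simp]: "add_pow (operator_rng T) (n::int) (op_fibre a) = op_fibre (int_scale n a)"
  unfolding add_pow_def
  using op_fibre_iso
  by (intro hom_int_pow[symmetric] group_additive_group group_add_operator_rng) (simp_all add: iso_def)

lemma mult_operator_rng [simp]:
  "op_fibre a \<otimes>\<^bsub>operator_rng T\<^esub> op_fibre b = op_fibre (coord_mult a b)"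
proof -
  have "op_fibre a \<otimes>\<^bsub>operator_rng T\<^esub> op_fibre b =
      (\<Union>s\<in>op_fibre a. \<Union>t\<in>op_fibre b. op_fibre (op_parity (F_mult T s t)))"
    by (simp add: operator_rng_def FactRing_def rcoset_mult_def a_r_coset_F_rng) (simp add: F_rng_def)
  also have "\<dots> = (\<Union>s\<in>op_fibre a. \<Union>t\<in>op_fibre b. op_fibre (coord_mult a b))"
    by (simp add: op_fibre_def op_parity_F_mult)
  also have "\<dots> = op_fibre (coord_mult a b)"
  \<comment> \<open>The library forms a product of cosets as a union over representatives. All
    members of the union agree, and nonempty fibres keep the union from being empty.\<close>
  proof -
    have "op_fibre m \<noteq> {}" for m
      using surj_op_parity unfolding op_fibre_def by (metis (mono_tags) empty_iff surjD vimage_singleton_eq)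
    then show ?thesis by simp
  qed
  finally show ?thesis .
qed

text \<open>The same argument as for the operator ideal, with the same four index choices. The range
  is a subgroup, which is all that the reduction to multiples of f \<otimes>
  \<open>e\<^sub>1\<close> uses, and \<open>r3\<close> minus \<open>r4\<close> again gives the
  2-torsion.\<close>

lemma range_two_step_B: "range (two_step_B \<mu>) = WE_EW_parity -` {0}"
proof
  note mu_add = additive.add[OF additive_mu] pure_tensor_add
  have quad: "quadadditive (\<lambda>a b c d. (\<mu> (a \<otimes>\<^sub>\<int> b \<otimes>\<^sub>\<int> c) \<otimes>\<^sub>\<int> d, - (a \<otimes>\<^sub>\<int> \<mu> (b \<otimes>\<^sub>\<int> c \<otimes>\<^sub>\<int> d))))"
    by (simp add: quadadditive_def additive_iff mu_add)
  have add: "additive (two_step_B \<mu>)"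
    unfolding two_step_B_def by (rule additive_tensor_lift4[OF quad])
  have pure: "two_step_B \<mu> (a \<otimes>\<^sub>\<int> b \<otimes>\<^sub>\<int> c \<otimes>\<^sub>\<int> d) =
      (\<mu> (a \<otimes>\<^sub>\<int> b \<otimes>\<^sub>\<int> c) \<otimes>\<^sub>\<int> d, - (a \<otimes>\<^sub>\<int> \<mu> (b \<otimes>\<^sub>\<int> c \<otimes>\<^sub>\<int> d)))" for a b c d
    unfolding two_step_B_def by (rule tensor_lift4_pure[OF quad])
  have "WE_EW_parity (two_step_B \<mu> t) = 0" for t
  proof (rule tensor4_additive_eq[of _ _ t])
    fix a b c d
    have eq: "two_step_B \<mu> (a \<otimes>\<^sub>\<int> b \<otimes>\<^sub>\<int> c \<otimes>\<^sub>\<int> d) =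
        (\<mu> (a \<otimes>\<^sub>\<int> b \<otimes>\<^sub>\<int> c) \<otimes>\<^sub>\<int> d, 0) - (0, a \<otimes>\<^sub>\<int> \<mu> (b \<otimes>\<^sub>\<int> c \<otimes>\<^sub>\<int> d))"
      by (simp add: pure)
    show "WE_EW_parity (two_step_B \<mu> (a \<otimes>\<^sub>\<int> b \<otimes>\<^sub>\<int> c \<otimes>\<^sub>\<int> d)) = 0"
      unfolding eq WE_EW_parity_def additive.diff[OF additive_WE_EW_sum] WE_EW_sum_WE WE_EW_sum_EW
        mu_eq even_iff_of_int_bit by simp
  qed (simp_all add: additive_iff additive.add[OF add] additive.add[OF additive_WE_EW_parity])
  then show "range (two_step_B \<mu>) \<subseteq> WE_EW_parity -` {0}" by auto
  let ?H = "range (two_step_B \<mu>)"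
  have H0: "0 \<in> ?H" using additive.zero[OF add] by (metis rangeI)
  have Hdiff: "x - y \<in> ?H" if "x \<in> ?H" "y \<in> ?H" for x y
    using that by (auto simp flip: additive.diff[OF add])
  have Hminus: "- x \<in> ?H" if "x \<in> ?H" for x using Hdiff[OF H0 that] by simp
  have Hadd: "x + y \<in> ?H" if "x \<in> ?H" "y \<in> ?H" for x y
    using Hdiff[OF that(1) Hminus[OF that(2)]] by simp
  have rel: "(\<mu> (a \<otimes>\<^sub>\<int> b \<otimes>\<^sub>\<int> c) \<otimes>\<^sub>\<int> d, - (a \<otimes>\<^sub>\<int> \<mu> (b \<otimes>\<^sub>\<int> c \<otimes>\<^sub>\<int> d))) \<in> ?H" for a b c d
    by (metis pure rangeI)
  have r1: "(1 \<otimes>\<^sub>\<int> (1, 0), - ((1, 0) \<otimes>\<^sub>\<int> 1)) \<in> ?H"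
    using rel[of "(1, 0)" "(1, 0)" "(1, 0)" "(1, 0)"] by (simp add: mu_eq)
  have r2: "(1 \<otimes>\<^sub>\<int> (0, 1), - ((1, 0) \<otimes>\<^sub>\<int> 1)) \<in> ?H"
    using rel[of "(1, 0)" "(1, 0)" "(1, 0)" "(0, 1)"] by (simp add: mu_eq)
  have r3: "(1 \<otimes>\<^sub>\<int> (1, 0), - ((0, 1) \<otimes>\<^sub>\<int> 1)) \<in> ?H"
    using rel[of "(0, 1)" "(1, 0)" "(1, 0)" "(1, 0)"] by (simp add: mu_eq)
  have neg: "(- 1) \<otimes>\<^sub>\<int> t = - (1 \<otimes>\<^sub>\<int> t)" for t :: "int \<times> int"
    using pure_tensor_diff(1)[of 0 1 t] by simp
  have r4: "(- (1 \<otimes>\<^sub>\<int> (1, 0)), - ((0, 1) \<otimes>\<^sub>\<int> 1)) \<in> ?H"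
    using rel[of "(0, 1)" "(0, 1)" "(0, 1)" "(1, 0)"] by (simp add: mu_eq neg)
  define g :: "int \<Rightarrow> (int \<otimes>\<^sub>\<int> (int \<times> int)) \<times> ((int \<times> int) \<otimes>\<^sub>\<int> int)" where
    "g k = (k \<otimes>\<^sub>\<int> (1, 0), 0)" for k
  have add_g: "additive g" by (simp add: additive_iff g_def pure_tensor_add)
  have red: "z - g (WE_EW_sum z) \<in> ?H" for z
    using generating_WE_EW
  proof (induction z rule: generating_induct)
    case zero
    show ?case by (simp add: additive.zero[OF additive_WE_EW_sum] additive.zero[OF add_g] H0)
  next
    case (diff x y)
    show ?case
      using Hdiff[OF diff] by (simp add: additive.diff[OF additive_WE_EW_sum] additive.diff[OF add_g] algebra_simps)
  next
    case (base z)
    have "(1 \<otimes>\<^sub>\<int> (0, 1) - 1 \<otimes>\<^sub>\<int> (1, 0), 0) \<in> ?H" using Hdiff[OF r2 r1] by simp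
    moreover have "(- (1 \<otimes>\<^sub>\<int> (1, 0)), (1, 0) \<otimes>\<^sub>\<int> 1) \<in> ?H" using Hminus[OF r1] by simp
    moreover have "(- (1 \<otimes>\<^sub>\<int> (1, 0)), (0, 1) \<otimes>\<^sub>\<int> 1) \<in> ?H" using Hminus[OF r3] by simp
    ultimately show ?case
      using base H0 by (auto simp: WE_EW_sum_WE WE_EW_sum_EW g_def simp flip: zero_prod_def)
  qed
  have even: "g (2 * k) \<in> ?H" for k
    using generating_int
  proof (induction k rule: generating_induct)
    case zero
    show ?case using H0 by (simp add: additive.zero[OF add_g])
  next
    case (diff x y)
    show ?case using Hdiff[OF diff] by (simp flip: additive.diff[OF add_g] add: right_diff_distrib)
  next
    case (base k)
    have "g 2 = (1 \<otimes>\<^sub>\<int> (1, 0) + 1 \<otimes>\<^sub>\<int> (1, 0), 0)"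
      by (simp add: g_def flip: pure_tensor_add)
    then show ?case using base Hdiff[OF r3 r4] by simp
  qed
  show "WE_EW_parity -` {0} \<subseteq> ?H"
  proof
    fix z assume "z \<in> WE_EW_parity -` {0}"
    then obtain k where "WE_EW_sum z = 2 * k"
      by (auto simp: WE_EW_parity_def even_iff_of_int_bit)
    then show "z \<in> ?H" using Hadd[OF red[of z] even[of k]] by simp
  qed
qed

lemma two_step_Q_eq: "two_step_Q \<mu> = additive_group Mod WE_EW_parity -` {0}"
  by (simp add: two_step_Q_def range_two_step_B)

definition Q_fibre :: "bit \<Rightarrow> ((int \<otimes>\<^sub>\<int> (int \<times> int)) \<times> ((int \<times> int) \<otimes>\<^sub>\<int> int)) set" where
  "Q_fibre c = WE_EW_parity -` {c}"

lemma Q_fibre_iso: "Q_fibre \<in> iso additive_group (two_step_Q \<mu>)"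
  unfolding two_step_Q_eq Q_fibre_def[abs_def]
  by (rule fibre_iso[OF additive_WE_EW_parity surj_WE_EW_parity])

lemma carrier_two_step_Q: "carrier (two_step_Q \<mu>) = range Q_fibre"
  using Q_fibre_iso by (simp add: iso_def bij_betw_def)

lemma mult_two_step_Q [simp]: "Q_fibre a \<otimes>\<^bsub>two_step_Q \<mu>\<^esub> Q_fibre b = Q_fibre (a + b)"
  using Q_fibre_iso hom_mult[of Q_fibre additive_group "two_step_Q \<mu>" a b] by (simp add: iso_def)

lemma one_two_step_Q: "\<one>\<^bsub>two_step_Q \<mu>\<^esub> = Q_fibre 0"
  by (simp add: two_step_Q_eq Q_fibre_def)

lemma two_step_Q_cong: "two_step_Q \<mu> \<cong> integer_mod_group 2"
proof -
  have "(of_int :: int \<Rightarrow> bit) \<in> iso (integer_mod_group 2) additive_group"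
    by (rule isoI) (simp_all add: hom_def of_int_mod_2_bit carrier_integer_mod_group bij_betw_of_int_bit)
  from iso_set_trans[OF this Q_fibre_iso]
  have "integer_mod_group 2 \<cong> two_step_Q \<mu>" by (auto simp: is_iso_def)
  then show ?thesis by (rule group.iso_sym[OF group_integer_mod_group])
qed

lemma class_EE_eq: "class_EE \<mu> t = op_fibre (EE_coords t, 0)"
proof -
  let ?f = "\<lambda>(x :: int \<times> int) (y :: int \<times> int). (x, 0 :: int) \<otimes>\<^sub>\<int> (1::int) \<otimes>\<^sub>\<int> (y, 0 :: int) \<otimes>\<^sub>\<int> (1::int)"
  have *: "(x + y, 0 :: int) = (x, 0) + (y, 0)" for x y :: "int \<times> int" by simp
  have "biadditive ?f"
    unfolding biadditive_def additive_iff by (intro conjI allI) (simp_all only: * pure_tensor_add)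
  note lift = additive_tensor_lift[OF this] tensor_lift_pure[OF this]
  have "op_parity \<circ> tensor_lift ?f = (\<lambda>t. (EE_coords t, 0))"
    by (rule tensor_lift_unique)
       (simp_all add: additive_iff additive.add[OF lift(1)] lift(2) additive.add[OF additive_op_parity]
         additive.add[OF additive_EE_coords] op_parity_pure EE_coords_pure)
  then show ?thesis
    by (simp add: class_EE_def operator_class_T fun_eq_iff)
qed

lemma class_WE_EW_eq: "class_WE_EW \<mu> z = op_fibre (0, WE_EW_parity z)"
proof -
  let ?f = "\<lambda>(w :: int) (y :: int \<times> int). (0 :: int \<times> int, w) \<otimes>\<^sub>\<int> (1::int) \<otimes>\<^sub>\<int> (y, 0 :: int) \<otimes>\<^sub>\<int> (1::int)"
  let ?g = "\<lambda>(x :: int \<times> int) (w :: int). (x, 0 :: int) \<otimes>\<^sub>\<int> (1::int) \<otimes>\<^sub>\<int> (0 :: int \<times> int, w) \<otimes>\<^sub>\<int> (1::int)"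
  have *: "(x + y, 0 :: int) = (x, 0) + (y, 0)" "(0 :: int \<times> int, w + v) = (0, w) + (0, v)"
    for x y :: "int \<times> int" and w v :: int by simp_all
  have f: "biadditive ?f" and g: "biadditive ?g"
    by (simp_all only: biadditive_def additive_iff * pure_tensor_add simp_thms)
  note lift = additive_tensor_lift[OF f] additive_tensor_lift[OF g]
  have "op_parity (tensor_lift ?f (fst z) + tensor_lift ?g (snd z)) = (0, WE_EW_parity z)"
  proof (rule generating_additive_eq[OF generating_WE_EW, of _ _ z])
    show "additive (\<lambda>z. op_parity (tensor_lift ?f (fst z) + tensor_lift ?g (snd z)))"
      unfolding additive_iff fst_add snd_add lift[THEN additive.add] additive.add[OF additive_op_parity]
      by (intro allI) (simp only: ac_simps)
    show "additive (\<lambda>z. (0 :: pair_coords, WE_EW_parity z))"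
      unfolding additive_iff additive.add[OF additive_WE_EW_parity] by simp
    have zero: "tensor_lift ?f 0 = 0" "tensor_lift ?g 0 = 0"
      by (rule lift[THEN additive.zero])+
    show "op_parity (tensor_lift ?f (fst b) + tensor_lift ?g (snd b)) = (0, WE_EW_parity b)"
      if "b \<in> {(1 \<otimes>\<^sub>\<int> (1, 0), 0), (1 \<otimes>\<^sub>\<int> (0, 1), 0), (0, (1, 0) \<otimes>\<^sub>\<int> 1), (0, (0, 1) \<otimes>\<^sub>\<int> 1)}" for b
      using that
      by (elim insertE emptyE)
         (simp_all add: zero tensor_lift_pure[OF f] tensor_lift_pure[OF g] op_parity_pure
           WE_EW_parity_def WE_EW_sum_WE WE_EW_sum_EW flip: zero_prod_def)
  qed
  then show ?thesis
    by (simp add: class_WE_EW_def operator_class_T case_prod_beta)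
qed

text \<open>The common value asked for by \<open>class_Q\<close> exists because
  \<open>class_WE_EW\<close> depends on the parity alone.\<close>

lemma class_Q_eq: "class_Q \<mu> (Q_fibre c) = op_fibre (0, c)"
  unfolding class_Q_def Q_fibre_def
  by (rule the_elem_image_fibre[where h = "\<lambda>c. op_fibre (0, c)", OF surj_WE_EW_parity class_WE_EW_eq])

lemma two_step_identification_eq:
  "two_step_identification \<mu> (t, Q_fibre c) = op_fibre (EE_coords t, c)"
  by (simp add: two_step_identification_def class_EE_eq class_Q_eq)

text \<open>Under the two labellings by fibres the map becomes \<open>EE_coords\<close> on the first
  component and the identity on the second, both bijective and additive.\<close>

lemma two_step_identification_iso:
  "two_step_identification \<mu> \<in> iso (additive_group \<times>\<times> two_step_Q \<mu>) (add_monoid (operator_rng T))"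
proof (rule isoI)
  show "two_step_identification \<mu> \<in> hom (additive_group \<times>\<times> two_step_Q \<mu>) (add_monoid (operator_rng T))"
    by (auto simp: hom_def carrier_two_step_Q two_step_identification_eq carrier_operator_rng
        additive.add[OF additive_EE_coords])
  have "inj_on (two_step_identification \<mu>) (carrier (additive_group \<times>\<times> two_step_Q \<mu>))"
    by (rule inj_onI)
       (auto simp: carrier_two_step_Q two_step_identification_eq dest: injD[OF bij_is_inj[OF bij_EE_coords]])
  moreover have "op_fibre m \<in> two_step_identification \<mu> ` carrier (additive_group \<times>\<times> two_step_Q \<mu>)" for m
  proof -
    obtain t where "fst m = EE_coords t" using bij_is_surj[OF bij_EE_coords] by (metis surjD)
    then have "op_fibre m = two_step_identification \<mu> (t, Q_fibre (snd m))"
      by (simp add: two_step_identification_eq prod_eq_iff)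
    then show ?thesis by (simp add: carrier_two_step_Q)
  qed
  ultimately show "bij_betw (two_step_identification \<mu>) (carrier (additive_group \<times>\<times> two_step_Q \<mu>))
      (carrier (add_monoid (operator_rng T)))"
    by (auto simp: bij_betw_def carrier_operator_rng carrier_two_step_Q two_step_identification_eq)
qed

text \<open>Each \<open>p\<^sub>i\<^sub>j\<close> has coordinate sum 1, so the product has label 1
  in Q, and \<open>bit\<close> has no other nonzero element.\<close>

lemma class_EE_product:
  assumes "q \<in> carrier (two_step_Q \<mu>)" "q \<noteq> \<one>\<^bsub>two_step_Q \<mu>\<^esub>"
  shows "class_EE \<mu> (e_basis i \<otimes>\<^sub>\<int> e_basis j) \<otimes>\<^bsub>operator_rng T\<^esub>
    class_EE \<mu> (e_basis k \<otimes>\<^sub>\<int> e_basis l) = class_Q \<mu> q"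
proof -
  obtain c where "q = Q_fibre c" "c \<noteq> 0"
    using assms unfolding carrier_two_step_Q one_two_step_Q by blast
  then have "q = Q_fibre 1" by (simp only: bit_not_zero_iff)
  then show ?thesis
    by (simp add: class_EE_eq class_Q_eq coord_mult_def EE_coords_pure coord_sum_def e_basis_def)
qed

end

section \<open>The regular representation and its defect\<close>

lemma ring_End_ring: "ring (End_ring :: ('t::ab_group_add \<Rightarrow> 't) ring)"
proof (rule ringI)
  show "abelian_group (End_ring :: ('t \<Rightarrow> 't) ring)"
  proof (rule abelian_groupI)
    fix f :: "'t \<Rightarrow> 't"
    assume "f \<in> carrier End_ring"
    then show "\<exists>g\<in>carrier End_ring. g \<oplus>\<^bsub>End_ring\<^esub> f = \<zero>\<^bsub>End_ring\<^esub>"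
      by (intro bexI[of _ "\<lambda>x. - f x"]) (auto simp: End_ring_def additive_iff)
  qed (auto simp: End_ring_def additive_iff algebra_simps)
  show "monoid (End_ring :: ('t \<Rightarrow> 't) ring)"
    by (rule monoidI) (auto simp: End_ring_def additive_iff)
qed (auto simp: End_ring_def additive_iff)

lemma zero_End_ring: "\<zero>\<^bsub>End_ring\<^esub> = (\<lambda>x. 0)"
  by (simp add: End_ring_def)

lemma add_pow_End_ring: "add_pow End_ring (n::int) id = (\<lambda>x. int_scale n x)"
proof
  fix x :: 'a
  interpret ring "End_ring :: ('a \<Rightarrow> 'a) ring" by (rule ring_End_ring)
  \<comment> \<open>Evaluation at \<open>x\<close> is a group homomorphism and therefore commutes
    with integer multiples.\<close>
  have "(\<lambda>f. f x) \<in> hom (add_monoid (End_ring :: ('a \<Rightarrow> 'a) ring)) additive_group"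
    by (simp add: hom_def End_ring_def)
  moreover have "id \<in> carrier (add_monoid (End_ring :: ('a \<Rightarrow> 'a) ring))"
    by (simp add: End_ring_def additive_iff)
  ultimately have "(id [^]\<^bsub>add_monoid (End_ring :: ('a \<Rightarrow> 'a) ring)\<^esub> n) x = int_scale n (id x)"
    by (rule hom_int_pow[OF _ _ a_group group_additive_group])
  then show "add_pow End_ring n id x = int_scale n x"
    by (simp add: add_pow_def)
qed

text \<open>This is the sum of the terms \<open>p\<^sub>i\<^sub>j\<close> times
  \<mu>(\<open>e\<^sub>i\<close>, \<open>e\<^sub>j\<close>, x), with the formula of
  \<open>mu_eq\<close> inserted. It maps into W and kills W.\<close>

definition coord_action :: "pair_coords \<Rightarrow> (int \<times> int) \<times> int \<Rightarrow> (int \<times> int) \<times> int" where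
  "coord_action p x =
     (0, coord_sum p * (fst (fst x) + snd (fst x)) - 2 * coord_last p * snd (fst x))"

lemma coord_action_add: "coord_action (p + p') x = coord_action p x + coord_action p' x"
  by (simp add: coord_action_def additive.add[OF additive_coord_sum]
      additive.add[OF additive_coord_last] algebra_simps)

lemma additive_coord_action: "additive (coord_action p)"
  by (simp add: coord_action_def additive_iff algebra_simps)

lemma coord_action_zero [simp]: "coord_action 0 x = 0"
  by (simp add: coord_action_def coord_sum_def coord_last_def zero_prod_def)

lemma coord_action_coord_action [simp]: "coord_action p (coord_action p' x) = 0"
  by (simp add: coord_action_def zero_prod_def)

lemma coord_action_int_scale: "coord_action (int_scale n p) x = int_scale n (coord_action p x)"
  by (rule additive_int_scale) (simp add: additive_iff coord_action_add)

definition kernel_coords :: "(pair_coords \<times> bit) set" where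
  "kernel_coords = {m. coord_sum (fst m) = 0 \<and> coord_last (fst m) = 0}"

lemma coord_action_eq_zero_iff: "(\<lambda>x. int_scale n x + coord_action (fst m) x) = (\<lambda>x. 0) \<longleftrightarrow>
  n = 0 \<and> m \<in> kernel_coords"
proof
  assume "(\<lambda>x. int_scale n x + coord_action (fst m) x) = (\<lambda>x. 0)"
  then have *: "int_scale n x + coord_action (fst m) x = 0" for x by meson
  show "n = 0 \<and> m \<in> kernel_coords"
    \<comment> \<open>At f only the scalar acts, so \<open>n = 0\<close>; at
      \<open>e\<^sub>1\<close> the coordinate sum S must vanish, and at \<open>e\<^sub>2\<close>
      then also twice the last coordinate.\<close>
    using *[of "(0, 1)"] *[of "((1, 0), 0)"] *[of "((0, 1), 0)"]
    by (simp add: coord_action_def int_scale_prod int_pow_additive_group_int kernel_coords_def zero_prod_def)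
next
  assume "n = 0 \<and> m \<in> kernel_coords"
  then show "(\<lambda>x. int_scale n x + coord_action (fst m) x) = (\<lambda>x. 0)"
    by (simp add: kernel_coords_def coord_action_def int_scale_zero_left zero_prod_def)
qed

context sign_tensor
begin

text \<open>Evaluating a tensor at \<open>x\<close> depends only on its E \<otimes> E coordinates,
  since elements of W act as zero in every slot; hence it is constant on cosets.\<close>

lemma regular_rep_op_fibre [simp]: "regular_rep T (op_fibre m) = coord_action (fst m)"
proof
  fix x :: "(int \<times> int) \<times> int"
  have quad: "quadadditive (\<lambda>a \<alpha> b \<beta>. T a \<alpha> b \<beta> x)"
    by (simp add: quadadditive_def additive_iff T_eq algebra_simps)
  have "tensor_lift4 (\<lambda>a \<alpha> b \<beta>. T a \<alpha> b \<beta> x) t = coord_action (fst (op_parity t)) x" for t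
  proof (rule tensor4_additive_eq[of _ _ t])
    show "additive (tensor_lift4 (\<lambda>a \<alpha> b \<beta>. T a \<alpha> b \<beta> x))"
      by (rule additive_tensor_lift4[OF quad])
    show "additive (\<lambda>t. coord_action (fst (op_parity t)) x)"
      by (simp add: additive_iff additive.add[OF additive_op_parity] coord_action_add)
    show "tensor_lift4 (\<lambda>a \<alpha> b \<beta>. T a \<alpha> b \<beta> x) (a \<otimes>\<^sub>\<int> \<alpha> \<otimes>\<^sub>\<int> b \<otimes>\<^sub>\<int> \<beta>) =
        coord_action (fst (op_parity (a \<otimes>\<^sub>\<int> \<alpha> \<otimes>\<^sub>\<int> b \<otimes>\<^sub>\<int> \<beta>))) x" for a \<alpha> b \<beta>
      unfolding tensor_lift4_pure[OF quad]
      by (simp add: T_eq op_parity_pure coord_action_def coord_sum_def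
          coord_last_def algebra_simps)
  qed
  then show "regular_rep T (op_fibre m) x = coord_action (fst m) x"
    unfolding regular_rep_def op_fibre_def
    by (rule the_elem_image_fibre[where h = "\<lambda>m. coord_action (fst m) x", OF surj_op_parity])
qed

lemma unital_regular_rep_op_fibre [simp]:
  "unital_regular_rep T (n, op_fibre m) = (\<lambda>x. int_scale n x + coord_action (fst m) x)"
  by (simp add: unital_regular_rep_def add_pow_End_ring) (simp add: End_ring_def)

section \<open>The unital operator ring and its representation\<close>

lemma unital_operator_ring_simps [simp]:
  "carrier (unital_operator_ring T) = UNIV \<times> range op_fibre"
  "\<zero>\<^bsub>unital_operator_ring T\<^esub> = (0, op_fibre 0)"
  "\<one>\<^bsub>unital_operator_ring T\<^esub> = (1, op_fibre 0)"
  "(n, op_fibre a) \<oplus>\<^bsub>unital_operator_ring T\<^esub> (m, op_fibre b) = (n + m, op_fibre (a + b))"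
  "(n, op_fibre a) \<otimes>\<^bsub>unital_operator_ring T\<^esub> (m, op_fibre b) =
     (n * m, op_fibre (int_scale n b + int_scale m a + coord_mult a b))"
  by (simp_all add: unital_operator_ring_def Let_def carrier_operator_rng)

lemma coord_mult_int_scale:
  "coord_mult (int_scale n a) b = int_scale n (coord_mult a b)"
  "coord_mult a (int_scale n b) = int_scale n (coord_mult a b)"
  by (rule additive_int_scale, simp add: additive_iff coord_mult_add)+

text \<open>Products lie in the Q part, where the coordinate sum is 0. Both bracketings of a triple
  product thus vanish, which settles associativity of the unital ring.\<close>

lemma coord_mult_coord_mult: "coord_mult (coord_mult a b) c = 0" "coord_mult a (coord_mult b c) = 0"
  by (simp_all add: coord_mult_def coord_sum_def zero_prod_def)

lemma ring_unital_operator_ring: "ring (unital_operator_ring T)"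
proof (rule ringI)
  let ?A = "unital_operator_ring T"
  show "abelian_group ?A"
  proof (rule abelian_groupI)
    fix u assume "u \<in> carrier ?A"
    then obtain n a where "u = (n, op_fibre a)" by auto
    then show "\<exists>v\<in>carrier ?A. v \<oplus>\<^bsub>?A\<^esub> u = \<zero>\<^bsub>?A\<^esub>"
      by (intro bexI[of _ "(- n, op_fibre (- a))"]) simp_all
  qed (auto simp: algebra_simps)
  show "monoid ?A"
    by (rule monoidI)
       (auto simp: int_scale_simps coord_mult_add coord_mult_int_scale coord_mult_zero
          coord_mult_coord_mult algebra_simps)
next
  fix u v w
  assume "u \<in> carrier (unital_operator_ring T)" "v \<in> carrier (unital_operator_ring T)"
    "w \<in> carrier (unital_operator_ring T)"
  then obtain n a m b k c where uvw: "u = (n, op_fibre a)" "v = (m, op_fibre b)" "w = (k, op_fibre c)"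
    by auto
  show "(u \<oplus>\<^bsub>unital_operator_ring T\<^esub> v) \<otimes>\<^bsub>unital_operator_ring T\<^esub> w =
      u \<otimes>\<^bsub>unital_operator_ring T\<^esub> w \<oplus>\<^bsub>unital_operator_ring T\<^esub> v \<otimes>\<^bsub>unital_operator_ring T\<^esub> w"
    and "w \<otimes>\<^bsub>unital_operator_ring T\<^esub> (u \<oplus>\<^bsub>unital_operator_ring T\<^esub> v) =
      w \<otimes>\<^bsub>unital_operator_ring T\<^esub> u \<oplus>\<^bsub>unital_operator_ring T\<^esub> w \<otimes>\<^bsub>unital_operator_ring T\<^esub> v"
    by (simp_all add: uvw int_scale_simps coord_mult_add algebra_simps)
qed

text \<open>For multiplicativity, two actions compose to zero because W is killed, while the product
  of two classes has no E \<otimes> E part and so also acts as zero.\<close>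

lemma unital_regular_rep_hom: "unital_regular_rep T \<in> ring_hom (unital_operator_ring T) End_ring"
proof (rule ring_hom_memI)
  fix u v
  assume "u \<in> carrier (unital_operator_ring T)" "v \<in> carrier (unital_operator_ring T)"
  then obtain n a m b where uv: "u = (n, op_fibre a)" "v = (m, op_fibre b)" by auto
  show "unital_regular_rep T u \<in> carrier End_ring"
  proof -
    have "additive (\<lambda>x. int_scale n x + coord_action (fst a) x)"
      by (rule additive.intro)
         (simp add: int_scale_add additive.add[OF additive_coord_action] algebra_simps)
    then show ?thesis by (simp add: uv End_ring_def)
  qed
  show "unital_regular_rep T (u \<oplus>\<^bsub>unital_operator_ring T\<^esub> v) =
      unital_regular_rep T u \<oplus>\<^bsub>End_ring\<^esub> unital_regular_rep T v"
    by (simp add: uv End_ring_def int_scale_add_left coord_action_add algebra_simps)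
  have "unital_regular_rep T (u \<otimes>\<^bsub>unital_operator_ring T\<^esub> v) x =
      (unital_regular_rep T u \<circ> unital_regular_rep T v) x" for x
    by (simp add: uv int_scale_simps coord_action_add coord_action_int_scale
        additive.add[OF additive_coord_action]
        additive_int_scale[OF additive_coord_action])
  then show "unital_regular_rep T (u \<otimes>\<^bsub>unital_operator_ring T\<^esub> v) =
      unital_regular_rep T u \<otimes>\<^bsub>End_ring\<^esub> unital_regular_rep T v"
    by (simp add: End_ring_def fun_eq_iff)
next
  show "unital_regular_rep T \<one>\<^bsub>unital_operator_ring T\<^esub> = \<one>\<^bsub>End_ring\<^esub>"
    by (simp add: End_ring_def int_scale_one id_def)
qed

section \<open>The defect and its square\<close>

lemma defect_eq: "defect T = op_fibre ` kernel_coords"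
proof -
  have "coord_action (fst m) = \<zero>\<^bsub>End_ring\<^esub> \<longleftrightarrow> m \<in> kernel_coords" for m
    using coord_action_eq_zero_iff[of 0 m] by (simp add: int_scale_zero_left zero_End_ring)
  then have "defect T = {u \<in> range op_fibre. u \<in> op_fibre ` kernel_coords}"
    unfolding defect_def a_kernel_def kernel_def by (simp add: carrier_operator_rng image_iff) fastforce
  then show ?thesis by blast
qed

lemma unital_defect_eq: "unital_defect T = (\<lambda>m. (0, op_fibre m)) ` kernel_coords"
proof -
  have *: "unital_regular_rep T (n, op_fibre m) = \<zero>\<^bsub>End_ring\<^esub> \<longleftrightarrow> n = 0 \<and> m \<in> kernel_coords" for n m
    by (simp only: unital_regular_rep_op_fibre coord_action_eq_zero_iff zero_End_ring)
  show ?thesis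
  proof (intro equalityI subsetI)
    fix u assume "u \<in> unital_defect T"
    then have u: "u \<in> carrier (unital_operator_ring T)" "unital_regular_rep T u = \<zero>\<^bsub>End_ring\<^esub>"
      by (simp_all add: unital_defect_def a_kernel_def kernel_def)
    from u(1) obtain n m where "u = (n, op_fibre m)" by auto
    with u(2) * show "u \<in> (\<lambda>m. (0 :: int, op_fibre m)) ` kernel_coords" by blast
  next
    fix u assume "u \<in> (\<lambda>m. (0 :: int, op_fibre m)) ` kernel_coords"
    then obtain m where "u = (0, op_fibre m)" "m \<in> kernel_coords" by blast
    with * show "u \<in> unital_defect T"
      by (simp add: unital_defect_def a_kernel_def kernel_def del: unital_regular_rep_op_fibre)
  qed
qed

lemma coord_mult_kernel_coords:
  "m \<in> kernel_coords \<Longrightarrow> coord_mult m a = 0" "m \<in> kernel_coords \<Longrightarrow> coord_mult a m = 0"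
  by (simp_all add: coord_mult_def kernel_coords_def zero_prod_def)

lemma defect_square_eq: "defect_square T = {(0, op_fibre 0)}"
proof
  have "z = (0, op_fibre 0)" if "z \<in> defect_square T" for z
    using that unfolding defect_square_def
    by induction (auto simp: unital_defect_eq coord_mult_kernel_coords int_scale_zero_left)
  then show "defect_square T \<subseteq> {(0, op_fibre 0)}" by blast
  have 0: "(0, op_fibre 0) \<in> unital_defect T"
    by (simp add: unital_defect_eq kernel_coords_def coord_sum_def coord_last_def image_iff zero_prod_def)
  show "{(0, op_fibre 0)} \<subseteq> defect_square T"
    \<comment> \<open>The inductive ideal product has clauses for products and sums only, so zero
      enters as 0 times 0.\<close>
    using ideal_prod.prod[OF 0 0, of "unital_operator_ring T"]
    by (simp add: defect_square_def int_scale_zero coord_mult_zero)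
qed

section \<open>The isomorphism type of the defect and of the conormal module\<close>

definition defect_param :: "int \<times> int \<times> int \<Rightarrow> pair_coords \<times> bit" where
  "defect_param = (\<lambda>(a, b, c). (((a, b), (- a - b, 0)), of_int c))"

text \<open>The lattice cut out by S p = 0 and \<open>p\<^sub>2\<^sub>2\<close> = 0 has the basis
  \<open>p\<^sub>1\<^sub>1\<close> - \<open>p\<^sub>2\<^sub>1\<close>,
  \<open>p\<^sub>1\<^sub>2\<close> - \<open>p\<^sub>2\<^sub>1\<close>; the third parameter is the
  multiple of q.\<close>

lemma bij_betw_defect_param: "bij_betw defect_param (UNIV \<times> UNIV \<times> {0..<2}) kernel_coords"
proof -
  have "inj_on defect_param (UNIV \<times> UNIV \<times> {0..<2})"
    using bij_betw_of_int_bit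
    by (auto simp: defect_param_def inj_on_def bij_betw_def)
  moreover have "m \<in> defect_param ` (UNIV \<times> UNIV \<times> {0..<2})" if "m \<in> kernel_coords" for m
  proof -
    obtain c where c: "c \<in> {0..<2}" "snd m = of_int c"
      using bij_betw_of_int_bit by (metis UNIV_I bij_betw_def imageE)
    obtain a b d where "fst m = ((a, b), d)" by (metis prod.collapse)
    then have "m = defect_param (a, b, c)"
      using that c by (cases d) (auto simp: defect_param_def kernel_coords_def coord_sum_def coord_last_def prod_eq_iff)
    then show ?thesis using c by blast
  qed
  moreover have "defect_param z \<in> kernel_coords" for z
    by (simp add: defect_param_def kernel_coords_def coord_sum_def coord_last_def split: prod.splits)
  ultimately show ?thesis by (auto simp: bij_betw_def)
qed

lemma defect_param_mult:
  "defect_param (x \<otimes>\<^bsub>integer_group \<times>\<times> integer_group \<times>\<times> integer_mod_group 2\<^esub> y) =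
   defect_param x + defect_param y"
  by (cases x; cases y) (simp add: defect_param_def DirProd_def of_int_mod_2_bit)

text \<open>It serves the defect in the rng and in the unital ring alike. The isomorphism starts
  from the known group, since inverting it requires the group axioms only for its source.\<close>

lemma cong_kernel_coords:
  assumes inj: "inj f" and G: "carrier G = f ` kernel_coords"
    and mult: "\<And>a b. f a \<otimes>\<^bsub>G\<^esub> f b = f (a + b)"
  shows "integer_group \<times>\<times> integer_group \<times>\<times> integer_mod_group 2 \<cong> G"
    and "G \<cong> integer_group \<times>\<times> integer_group \<times>\<times> integer_mod_group 2"
proof -
  let ?Z = "integer_group \<times>\<times> integer_group \<times>\<times> integer_mod_group 2"
  have carrier: "carrier ?Z = UNIV \<times> UNIV \<times> {0..<2}"
    by (simp add: DirProd_def carrier_integer_mod_group)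
  have "bij_betw f kernel_coords (carrier G)"
    using inj_on_subset[OF inj] by (simp add: G bij_betw_def)
  from bij_betw_trans[OF bij_betw_defect_param this]
  have bij: "bij_betw (f \<circ> defect_param) (carrier ?Z) (carrier G)"
    by (simp only: carrier)
  have "(f \<circ> defect_param) \<in> iso ?Z G"
    using bij by (intro isoI) (simp_all add: hom_def mult bij_betw_imp_funcset defect_param_mult del: mult_DirProd)
  then show cong: "?Z \<cong> G" by (auto simp: is_iso_def)
  have "group ?Z" by (intro DirProd_group) simp_all
  then show "G \<cong> ?Z" using cong by (rule group.iso_sym)
qed

lemma defect_cong: "additive_subgroup_of (operator_rng T) (defect T)
    \<cong> integer_group \<times>\<times> integer_group \<times>\<times> integer_mod_group 2"
  by (rule cong_kernel_coords(2)[of op_fibre])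
     (simp_all add: additive_subgroup_of_def defect_eq inj_def del: split_paired_All)

lemma
  shows cong_unital_defect: "integer_group \<times>\<times> integer_group \<times>\<times> integer_mod_group 2
      \<cong> additive_subgroup_of (unital_operator_ring T) (unital_defect T)"
    and unital_defect_cong: "additive_subgroup_of (unital_operator_ring T) (unital_defect T)
      \<cong> integer_group \<times>\<times> integer_group \<times>\<times> integer_mod_group 2"
  by (rule cong_kernel_coords[of "\<lambda>m. (0, op_fibre m)"],
      simp_all add: additive_subgroup_of_def unital_defect_eq inj_def del: split_paired_All)+

text \<open>The square of the defect is the zero subgroup, so cosets are singletons and the
  projection is \<open>x\<close> to \<open>{x}\<close>.\<close>

lemma conormal_iso:
  "(\<lambda>x. defect_square T #>\<^bsub>additive_subgroup_of (unital_operator_ring T) (unital_defect T)\<^esub> x)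
     \<in> iso (additive_subgroup_of (unital_operator_ring T) (unital_defect T)) (conormal T)"
proof -
  let ?K = "additive_subgroup_of (unital_operator_ring T) (unital_defect T)"
  have coset: "defect_square T #>\<^bsub>?K\<^esub> x = {x}" if "x \<in> carrier ?K" for x
    using that by (auto simp: r_coset_def defect_square_eq additive_subgroup_of_def unital_defect_eq)
  have closed: "x \<otimes>\<^bsub>?K\<^esub> y \<in> carrier ?K" if "x \<in> carrier ?K" "y \<in> carrier ?K" for x y
    using that by (auto simp: additive_subgroup_of_def unital_defect_eq kernel_coords_def
      coord_sum_def coord_last_def intro!: imageI)
  have carrier: "carrier (conormal T) = (\<lambda>x. {x}) ` carrier ?K"
    unfolding conormal_def carrier_FactGroup by (rule image_cong[OF refl coset])
  have mult: "{x} \<otimes>\<^bsub>conormal T\<^esub> {y} = {x \<otimes>\<^bsub>?K\<^esub> y}" for x y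
    by (simp add: conormal_def set_mult_def)
  show ?thesis
  proof (rule isoI)
    show "(\<lambda>x. defect_square T #>\<^bsub>?K\<^esub> x) \<in> hom ?K (conormal T)"
      by (rule homI) (auto simp only: coset mult closed carrier)
    have "bij_betw (\<lambda>x. {x}) (carrier ?K) (carrier (conormal T))"
      by (simp add: carrier bij_betw_def)
    then show "bij_betw (\<lambda>x. defect_square T #>\<^bsub>?K\<^esub> x) (carrier ?K) (carrier (conormal T))"
      by (simp only: bij_betw_cong[OF coset])
  qed
qed

lemma conormal_cong: "conormal T \<cong> integer_group \<times>\<times> integer_group \<times>\<times> integer_mod_group 2"
proof -
  have "additive_subgroup_of (unital_operator_ring T) (unital_defect T) \<cong> conormal T"
    using conormal_iso by (auto simp: is_iso_def)
  then have "integer_group \<times>\<times> integer_group \<times>\<times> integer_mod_group 2 \<cong> conormal T"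
    by (rule iso_trans[OF cong_unital_defect])
  then show ?thesis
    by (rule group.iso_sym[rotated]) (intro DirProd_group, simp_all)
qed

lemma operator_rng_annihilates_defect:
  assumes "u \<in> carrier (operator_rng T)" "d \<in> defect T"
  shows "u \<otimes>\<^bsub>operator_rng T\<^esub> d = \<zero>\<^bsub>operator_rng T\<^esub>" "d \<otimes>\<^bsub>operator_rng T\<^esub> u = \<zero>\<^bsub>operator_rng T\<^esub>"
proof -
  obtain a b where "u = op_fibre a" "d = op_fibre b" "b \<in> kernel_coords"
    using assms unfolding carrier_operator_rng defect_eq by blast
  then show "u \<otimes>\<^bsub>operator_rng T\<^esub> d = \<zero>\<^bsub>operator_rng T\<^esub>" "d \<otimes>\<^bsub>operator_rng T\<^esub> u = \<zero>\<^bsub>operator_rng T\<^esub>"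
    by (simp_all add: coord_mult_kernel_coords)
qed

section \<open>The regular extension and its lack of a section\<close>

lemma square_zero_extension_regular:
  "square_zero_extension (unital_defect T) (unital_operator_ring T) (regular_image T) (unital_regular_rep T)"
proof -
  have "ring_hom_ring (unital_operator_ring T) End_ring (unital_regular_rep T)"
    by (rule ring_hom_ringI2[OF ring_unital_operator_ring ring_End_ring unital_regular_rep_hom])
  then have "ring (regular_image T)"
    unfolding regular_image_def by (rule ring_hom_ring.img_is_ring)
  moreover have "unital_regular_rep T \<in> ring_hom (unital_operator_ring T) (regular_image T)"
    using unital_regular_rep_hom by (auto simp: ring_hom_def regular_image_def)
  moreover have "a_kernel (unital_operator_ring T) (regular_image T) (unital_regular_rep T) = unital_defect T"
    by (simp add: unital_defect_def a_kernel_def kernel_def regular_image_def)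
  moreover have "unital_defect T \<cdot>\<^bsub>unital_operator_ring T\<^esub> unital_defect T = {\<zero>\<^bsub>unital_operator_ring T\<^esub>}"
    using defect_square_eq unfolding defect_square_def unital_operator_ring_simps .
  moreover have "unital_regular_rep T ` carrier (unital_operator_ring T) = carrier (regular_image T)"
    by (simp add: regular_image_def)
  ultimately show ?thesis
    unfolding square_zero_extension_def using ring_unital_operator_ring by blast
qed

text \<open>
  The action of \<open>p\<^sub>1\<^sub>1\<close> squares to zero, while every lift of it to the unital operator ring has
  the odd coordinate sum \<open>1\<close>, so that the square of the lift is the nonzero class \<open>q\<close>.
\<close>

lemma no_unital_ring_section:
  "\<not> has_unital_ring_section (unital_operator_ring T) (regular_image T) (unital_regular_rep T)"
proof
  assume "has_unital_ring_section (unital_operator_ring T) (regular_image T) (unital_regular_rep T)"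
  then obtain s where s: "s \<in> ring_hom (regular_image T) (unital_operator_ring T)"
    and sec: "\<And>r. r \<in> carrier (regular_image T) \<Longrightarrow> unital_regular_rep T (s r) = r"
    by (auto simp: has_unital_ring_section_def)
  have carrier: "unital_regular_rep T (n, op_fibre m) \<in> carrier (regular_image T)" for n m
    by (simp add: regular_image_def del: unital_regular_rep_op_fibre)
  define r where "r = coord_action ((1, 0), (0, 0))"
  have r: "r \<in> carrier (regular_image T)" 
    using carrier[of 0 "(((1, 0), (0, 0)), 0)"] by (simp add: r_def int_scale_zero_left)
  have zero: "(\<lambda>x. 0) \<in> carrier (regular_image T)"
    using carrier[of 0 0] by (simp add: int_scale_zero_left)
  have rr: "r \<otimes>\<^bsub>regular_image T\<^esub> r = (\<lambda>x. 0)"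
    by (simp add: regular_image_def End_ring_def r_def fun_eq_iff)
  \<comment> \<open>\<open>ring_hom\<close> has no clause for zero; that \<open>s\<close> preserves
    it follows from 0 + 0 = 0 by cancelling in the first component and in the label.\<close>
  have "(\<lambda>x. 0) \<oplus>\<^bsub>regular_image T\<^esub> (\<lambda>x. 0) = (\<lambda>x. 0)"
    by (simp add: regular_image_def End_ring_def)
  then have "s (\<lambda>x. 0) \<oplus>\<^bsub>unital_operator_ring T\<^esub> s (\<lambda>x. 0) = s (\<lambda>x. 0)"
    using ring_hom_add[OF s zero zero] by simp
  moreover obtain k c where "s (\<lambda>x. 0) = (k, op_fibre c)"
    using ring_hom_closed[OF s zero] by auto
  ultimately have s0: "s (\<lambda>x. 0) = (0, op_fibre 0)" by simp
  obtain n m where sr: "s r = (n, op_fibre m)"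
    using ring_hom_closed[OF s r] by auto
  have "int_scale n x + coord_action (fst m) x = r x" for x
    using sec[OF r] by (auto simp: sr)
  \<comment> \<open>Evaluation at f shows that the lift has no scalar part, and evaluation at
    \<open>e\<^sub>1\<close> reads off its coordinate sum.\<close>
  from this[of "(0, 1)"] this[of "((1, 0), 0)"]
  have n: "n = 0" and m: "coord_sum (fst m) = 1"
    by (simp_all add: r_def coord_action_def int_scale_prod int_pow_additive_group_int coord_sum_def coord_last_def)
  have "s r \<otimes>\<^bsub>unital_operator_ring T\<^esub> s r = (0, op_fibre 0)"
    using ring_hom_mult[OF s r r] unfolding rr s0 by (rule sym)
  then show False
    by (simp add: sr n m int_scale_zero_left coord_mult_def zero_prod_def)
qed

end

theorem theorem16p1:
  fixes \<mu> :: "(int \<times> int) \<otimes>\<^sub>\<int> (int \<times> int) \<otimes>\<^sub>\<int> (int \<times> int) \<Rightarrow> int"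
  assumes "additive \<mu>"
    and "\<forall>i\<in>{1, 2}. \<forall>j\<in>{1, 2}. \<forall>k\<in>{1, 2}.
      \<mu> (e_basis i \<otimes>\<^sub>\<int> e_basis j \<otimes>\<^sub>\<int> e_basis k) = (if (i, j, k) = (2, 2, 2) then - 1 else 1)"
    and "T = two_step_op \<mu>"
  shows "two_step_Q \<mu> \<cong> integer_mod_group 2 \<and>
    two_step_identification \<mu>
       \<in> iso (additive_group \<times>\<times> two_step_Q \<mu>) (add_monoid (operator_rng T)) \<and>
    (\<forall>q\<in>carrier (two_step_Q \<mu>). q \<noteq> \<one>\<^bsub>two_step_Q \<mu>\<^esub> \<longrightarrow>
       (\<forall>i\<in>{1, 2}. \<forall>j\<in>{1, 2}. \<forall>k\<in>{1, 2}. \<forall>l\<in>{1, 2}.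
          class_EE \<mu> (e_basis i \<otimes>\<^sub>\<int> e_basis j) \<otimes>\<^bsub>operator_rng T\<^esub>
          class_EE \<mu> (e_basis k \<otimes>\<^sub>\<int> e_basis l) = class_Q \<mu> q)) \<and>
    (\<lambda>u. (0, u)) ` defect T = unital_defect T \<and>
    defect_square T = {\<zero>\<^bsub>unital_operator_ring T\<^esub>} \<and>
    (\<lambda>x. defect_square T #>\<^bsub>additive_subgroup_of (unital_operator_ring T) (unital_defect T)\<^esub> x)
       \<in> iso (additive_subgroup_of (unital_operator_ring T) (unital_defect T)) (conormal T) \<and>
    additive_subgroup_of (operator_rng T) (defect T)
       \<cong> integer_group \<times>\<times> integer_group \<times>\<times> integer_mod_group 2 \<and>
    additive_subgroup_of (unital_operator_ring T) (unital_defect T)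
       \<cong> integer_group \<times>\<times> integer_group \<times>\<times> integer_mod_group 2 \<and>
    conormal T \<cong> integer_group \<times>\<times> integer_group \<times>\<times> integer_mod_group 2 \<and>
    (\<forall>u\<in>carrier (operator_rng T). \<forall>d\<in>defect T.
       u \<otimes>\<^bsub>operator_rng T\<^esub> d = \<zero>\<^bsub>operator_rng T\<^esub> \<and>
       d \<otimes>\<^bsub>operator_rng T\<^esub> u = \<zero>\<^bsub>operator_rng T\<^esub>) \<and>
    square_zero_extension (unital_defect T) (unital_operator_ring T) (regular_image T)
       (unital_regular_rep T) \<and>
    \<not> has_unital_ring_section (unital_operator_ring T) (regular_image T)
       (unital_regular_rep T)"
proof -
  interpret S: sign_tensor \<mu> by (rule sign_tensor.intro[OF assms(1,2)])
  have defect: "(\<lambda>u. (0, u)) ` defect S.T = unital_defect S.T"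
    unfolding S.defect_eq S.unital_defect_eq by (rule image_image)
  have square: "defect_square S.T = {\<zero>\<^bsub>unital_operator_ring S.T\<^esub>}"
    unfolding S.unital_operator_ring_simps by (rule S.defect_square_eq)
  show ?thesis
    unfolding assms(3)
    by (intro conjI ballI impI S.two_step_Q_cong S.two_step_identification_iso S.class_EE_product
        defect square S.conormal_iso S.defect_cong S.unital_defect_cong S.conormal_cong
        S.operator_rng_annihilates_defect S.square_zero_extension_regular S.no_unital_ring_section)
qed

end
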